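(* Let $q\in(1,2_\theta^*]$ with $q<\infty$, let $h$ be an admissible space step, and let $\mathbf u^0\in\mathbb R^{\mathbb Z}$ satisfy $(\mathbf u^0)_i=0$ for $|i|>M_x$ and $\mathbf u^0\not\equiv0$. Let $C>0$ be any constant such that $\|\mathbf f\|_{\ell^q_{h'}(\mathbb R)}\le C\|\mathbf f\|_{\mathcal X^\theta_{h'}(I)}$ for every admissible $h'$ and every $\mathbf f\in\mathcal X^\theta_{h'}(I)$. Let $\mathbf v:t\ge0\mapsto(v_i(t))_{i\in\mathbb Z}$ be the solution of the semi-discrete scheme with initial datum $\mathbf u^0$, and let $R(t):=\|\mathbf v(t)\|^2_{\mathcal X^\theta_h(I)}/\|\mathbf v(t)\|^2_{\ell^q_h(\mathbb R)}$ whenever $\mathbf v(t)\not\equiv 0$ (so $R(0)=\|\mathbf u^0\|^2_{\mathcal X^\theta_h(I)}/\|\mathbf u^0\|^2_{\ell^q_h(\mathbb R)}$). Then: (1) if $q\neq2$, for any $t>0$, $$\left(\|\mathbf u^0\|_{\ell^q_h(\mathbb R)}^{-(2-q)}+\frac{2-q}{q-1}R(0)t\right)_+^{\frac{-1}{2-q}}\le\|\mathbf v(t)\|_{\ell^q_h(\mathbb R)}\le\left(\|\mathbf u^0\|_{\ell^q_h(\mathbb R)}^{-(2-q)}+\frac{2-q}{q-1}C^{-2}t\right)_+^{\frac{-1}{2-q}};$$ (2) if $2<q\le2_\theta^*$, there exists $t_*^h>0$ such that for any $t>0$, $$\left(\frac{q-2}{q-1}C^{-2}(t_*^h-t)\right)_+^{1/(q-2)}\le\|\mathbf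 v(t)\|_{\ell^q_h(\mathbb R)}\le\left(\frac{q-2}{q-1}R(0)(t_*^h-t)\right)_+^{1/(q-2)};$$ (3) the discrete Rayleigh quotient $t\mapsto R(t)$ is non-increasing on $[0,\infty)$ if $q\in(1,2]$, and on $[0,t_*^h)$ if $q\in(2,2_\theta^*]$ (with $t_*^h$ as in (2)).
   Context: Fix $\theta\in(0,1)$, $L>0$, $I=(-L,L)$. $2_\theta^*:=2/(1-2\theta)_+$, equal to $+\infty$ if $2\theta\ge1$; $a_+:=\max(a,0)$. A space step $h>0$ is admissible if $L=(M_x+1)h$ for some integer $M_x\ge1$. Bold letters denote elements of $\mathbb R^{\mathbb Z}$. Powers of possibly negative quantities are odd powers: $a^{s}:=|a|^{s-1}a$ for $a\ne0$, $s>0$, and $0^s:=0$. Weights: let $C_{1,\theta}=\left(\int_{\mathbb R}\frac{1-\cos\xi}{|\xi|^{1+2\theta}}d\xi\right)^{-1}$ and, for $t>0$, $G(t)=\frac{C_{1,\theta}}{(2-2\theta)(2\theta-1)2\theta}t^{2-2\theta}$ if $2\theta\ne1$, $G(t)=C_{1,\theta}(t-t\log t)$ if $2\theta=1$. The weights are symmetric, $w^h_{-j}=w^h_j$, with $w_0^h:=0$ (its value plays no role) and for $j\ge1$: $w_1^h=h^{-2\theta}\left[\frac{C_{1,\theta}}{2-2\theta}-G''(1)-\frac{G'(3)+3G'(1)}2+G(3)-G(1)\right]$; $w^h_j=2h^{-2\theta}[G'(j+1)+G'(j-1)-G(j+1)+G(j-1)]$ for $j$ even; $w_j^h=h^{-2\theta}\left[-\frac{G'(j+2)+6G'(j)+G'(j-2)}2+G(j+2)-G(j-2)\right]$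 for $j\ge3$ odd. (Known fact: there are constants $b_\theta,B_\theta>0$ depending only on $\theta$ with $b_\theta h|jh|^{-1-2\theta}\le w_j^h\le B_\theta h|jh|^{-1-2\theta}$ for $j\neq0$.) Discrete fractional Laplacian: $[(-\Delta)^\theta_h\mathbf f]_i=\sum_{j\in\mathbb Z}w_j^h(f_i-f_{i-j})$. Norms: $\|\mathbf f\|_{\ell^q_h(\mathbb R)}=\left(\sum_{i\in\mathbb Z}h|f_i|^q\right)^{1/q}$; $\mathcal X^\theta_h(I)=\{\mathbf f\in\mathbb R^{\mathbb Z}: f_i=0\text{ for }|i|>M_x\}$ with $\|\mathbf f\|_{\mathcal X^\theta_h(I)}=\left(\frac12\sum_{i,j\in\mathbb Z}h\,w_j^h|f_i-f_{i-j}|^2\right)^{1/2}$. Semi-discrete scheme with initial datum $\mathbf u^0$: the unique $\mathbf v(t)=(v_i(t))_{i\in\mathbb Z}$, $t\ge0$, with $v_i^{q-1}\in W^{1,1}(0,T;\mathbb R)$ for all $T>0$ (continuous representatives are used), such that $\frac{d}{dt}v_i^{q-1}(t)+[(-\Delta)^\theta_h\mathbf v(t)]_i=0$ for $|i|\le M_x$ and a.e. $t>0$; $v_i(t)=0$ for $|i|\ge M_x+1$, $t\ge0$; $v_i(0)=(\mathbf u^0)_i$ for $|i|\le M_x$ (existence and uniqueness hold). *)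

theory Defs
  imports "HOL-Analysis.Analysis"
begin

definition pos_part :: "real \<Rightarrow> real" where
  "pos_part a = max a 0"

definition two_star :: "real \<Rightarrow> ereal" where
  "two_star \<theta> = (if 2 * \<theta> \<ge> 1 then \<infinity> else ereal (2 / (1 - 2 * \<theta>)))"

text \<open>The odd power \<open>\<bar>a\<bar>\<^sup>s\<^sup>-\<^sup>1 a\<close>, with value \<open>0\<close> at \<open>a = 0\<close>; note \<open>sgn 0 = 0\<close>.\<close>

definition odd_pow :: "real \<Rightarrow> real \<Rightarrow> real" where
  "odd_pow a s = sgn a * \<bar>a\<bar> powr s"

text \<open>\<open>h\<close> is an admissible space step for \<open>I = (-L, L)\<close>, with \<open>M\<close> interior grid points
  on each side of the origin; \<open>M\<close> is determined by \<open>L\<close> and \<open>h\<close>.\<close>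

definition space_step :: "real \<Rightarrow> real \<Rightarrow> nat \<Rightarrow> bool" where
  "space_step L h M \<longleftrightarrow> h > 0 \<and> M \<ge> 1 \<and> L = (real M + 1) * h"

definition C1 :: "real \<Rightarrow> real" where
  "C1 \<theta> = inverse (LBINT \<xi>. (1 - cos \<xi>) / \<bar>\<xi>\<bar> powr (1 + 2 * \<theta>))"

text \<open>Only the values and derivatives of \<open>wG\<close> at points \<open>t \<ge> 1\<close> are used.\<close>

definition wG :: "real \<Rightarrow> real \<Rightarrow> real" where
  "wG \<theta> t = (if 2 * \<theta> \<noteq> 1
     then C1 \<theta> / ((2 - 2 * \<theta>) * (2 * \<theta> - 1) * (2 * \<theta>)) * t powr (2 - 2 * \<theta>)
     else C1 \<theta> * (t - t * ln t))"

definition weight_nat :: "real \<Rightarrow> real \<Rightarrow> nat \<Rightarrow> real" where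
  "weight_nat \<theta> h n =
     (let G = wG \<theta>; G' = deriv G; G'' = deriv G'; j = real n in
      if n = 0 then 0
      else if n = 1 then
        h powr (- 2 * \<theta>) * (C1 \<theta> / (2 - 2 * \<theta>) - G'' 1 - (G' 3 + 3 * G' 1) / 2 + G 3 - G 1)
      else if even n then
        2 * h powr (- 2 * \<theta>) * (G' (j + 1) + G' (j - 1) - G (j + 1) + G (j - 1))
      else
        h powr (- 2 * \<theta>) * (- (G' (j + 2) + 6 * G' j + G' (j - 2)) / 2 + G (j + 2) - G (j - 2)))"

definition weight :: "real \<Rightarrow> real \<Rightarrow> int \<Rightarrow> real" where
  "weight \<theta> h j = weight_nat \<theta> h (nat \<bar>j\<bar>)"

definition frac_lap :: "real \<Rightarrow> real \<Rightarrow> (int \<Rightarrow> real) \<Rightarrow> int \<Rightarrow> real" where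
  "frac_lap \<theta> h f i = (\<Sum>\<^sub>\<infinity>j\<in>UNIV. weight \<theta> h j * (f i - f (i - j)))"

definition lq_norm :: "real \<Rightarrow> real \<Rightarrow> (int \<Rightarrow> real) \<Rightarrow> real" where
  "lq_norm h q f = (\<Sum>\<^sub>\<infinity>i\<in>UNIV. h * \<bar>f i\<bar> powr q) powr (1 / q)"

definition X_space :: "nat \<Rightarrow> (int \<Rightarrow> real) set" where
  "X_space M = {f. \<forall>i. \<bar>i\<bar> > int M \<longrightarrow> f i = 0}"

definition X_norm :: "real \<Rightarrow> real \<Rightarrow> (int \<Rightarrow> real) \<Rightarrow> real" where
  "X_norm \<theta> h f =
     sqrt (1 / 2 * (\<Sum>\<^sub>\<infinity>(i, j)\<in>UNIV. h * weight \<theta> h j * \<bar>f i - f (i - j)\<bar>\<^sup>2))"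

text \<open>Meaningful only for \<open>f\<close> not identically zero.\<close>

definition rayleigh :: "real \<Rightarrow> real \<Rightarrow> real \<Rightarrow> (int \<Rightarrow> real) \<Rightarrow> real" where
  "rayleigh \<theta> h q f = (X_norm \<theta> h f)\<^sup>2 / (lq_norm h q f)\<^sup>2"

text \<open>Test functions: the class \<open>C\<^sub>c\<^sup>\<infinity>(0, T)\<close>, extended by zero to the real line. The closure
  below is compact, being a closed subset of a bounded interval.\<close>

definition test_function :: "real \<Rightarrow> (real \<Rightarrow> real) \<Rightarrow> bool" where
  "test_function T \<phi> \<longleftrightarrow>
     (\<forall>k x. ((deriv ^^ k) \<phi>) differentiable (at x)) \<and>
     closure {x. \<phi> x \<noteq> 0} \<subseteq> {0<..<T}"

text \<open>\<open>g \<in> L\<^sup>1(0, T)\<close> is the distributional derivative of \<open>u \<in> L\<^sup>1(0, T)\<close>; the space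
  \<open>W\<^sup>1\<^sup>,\<^sup>1(0, T)\<close> consists of the \<open>u\<close> having such a \<open>g\<close>, which is unique almost everywhere.\<close>

definition has_weak_deriv :: "real \<Rightarrow> (real \<Rightarrow> real) \<Rightarrow> (real \<Rightarrow> real) \<Rightarrow> bool" where
  "has_weak_deriv T u g \<longleftrightarrow>
     set_integrable lborel {0<..<T} u \<and> set_integrable lborel {0<..<T} g \<and>
     (\<forall>\<phi>. test_function T \<phi> \<longrightarrow>
        (LBINT t:{0<..<T}. u t * deriv \<phi> t) = - (LBINT t:{0<..<T}. g t * \<phi> t))"

definition W11 :: "real \<Rightarrow> (real \<Rightarrow> real) set" where
  "W11 T = {u. \<exists>g. has_weak_deriv T u g}"

text \<open>The continuity clause expresses that \<open>v\<^sub>i\<^sup>q\<^sup>-\<^sup>1\<close> is taken to be its continuous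
  representative on \<open>[0, \<infinity>)\<close>. Values \<open>v t\<close> for \<open>t < 0\<close> are unconstrained and irrelevant.\<close>

definition semidiscrete_solution ::
  "real \<Rightarrow> real \<Rightarrow> nat \<Rightarrow> real \<Rightarrow> (int \<Rightarrow> real) \<Rightarrow> (real \<Rightarrow> int \<Rightarrow> real) \<Rightarrow> bool" where
  "semidiscrete_solution \<theta> h M q u0 v \<longleftrightarrow>
     (\<forall>i. continuous_on {0..} (\<lambda>t. odd_pow (v t i) (q - 1))) \<and>
     (\<forall>i. \<forall>T>0. (\<lambda>t. odd_pow (v t i) (q - 1)) \<in> W11 T) \<and>
     (\<forall>i. \<bar>i\<bar> \<le> int M \<longrightarrow> (\<forall>T>0. \<exists>g.
        has_weak_deriv T (\<lambda>t. odd_pow (v t i) (q - 1)) g \<and>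
        (AE t in lborel. t \<in> {0<..<T} \<longrightarrow> g t + frac_lap \<theta> h (v t) i = 0))) \<and>
     (\<forall>i. \<bar>i\<bar> \<ge> int M + 1 \<longrightarrow> (\<forall>t\<ge>0. v t i = 0)) \<and>
     (\<forall>i. \<bar>i\<bar> \<le> int M \<longrightarrow> v 0 i = u0 i)"

end

theory Submission
  imports Defs
begin

text \<open>
  Only the interior nodes matter, so the scheme is a finite system \<open>a' = - K v\<close> with \<open>K\<close>
  symmetric and \<open>v = a\<^sup>p\<close> (odd power), \<open>p = 1 / (q - 1)\<close>. The embedding inequality alone makes
  the weights summable and \<open>K\<close> positive definite. With \<open>m = h \<Sum> \<bar>v\<bar>\<^sup>q\<close> one has
  \<open>m' = - q / (q - 1) \<cdot> R m\<^bsup>2/q\<^esup>\<close>, and all the bounds follow from \<open>C\<^sup>-\<^sup>2 \<le> R \<le> R 0\<close>.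

  The point is the monotonicity of \<open>R\<close>, because \<open>v\<close> need not be differentiable where it vanishes
  if \<open>q > 2\<close>. The system is a gradient flow in the norm dual to \<open>K\<close>, hence a contraction in that
  norm, and if \<open>a\<close> is a solution then so is \<open>c a (c\<^bsup>p - 1\<^esup> t + d)\<close>. Applying the contraction to \<open>a\<close>
  and an infinitesimal scaling and translation of it shows that for all \<open>\<alpha>, \<beta>\<close> the dual norm of
  \<open>\<alpha> a + (\<beta> + (p - 1) \<alpha> t) a'\<close> is non-increasing. The square of this norm involves only
  differentiable quantities and \<open>\<parallel>v\<parallel>\<^sup>2\<close> in the energy norm, and for \<open>\<alpha> / \<beta>\<close> chosen at a given time
  it says exactly that the upper right derivative of \<open>R\<close> is at most 0.
\<close>

section \<open>Smooth functions of compact support\<close>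

text \<open>Differentiating \<open>exp (- 1 / x)\<close> only produces further powers of
  \<open>1 / x\<close>. The exponent \<open>n\<close> is carried along so that the span of this
  family is closed under differentiation.\<close>

definition exp_inv :: "nat \<Rightarrow> real \<Rightarrow> real" where
  "exp_inv n x = (if x > 0 then (1 / x) ^ n * exp (- 1 / x) else 0)"

lemma exp_inv_nonneg: "0 \<le> exp_inv n x"
  by (simp add: exp_inv_def)

lemma exp_inv_pos: "0 < x \<Longrightarrow> 0 < exp_inv n x"
  by (simp add: exp_inv_def)

text \<open>As \<open>exp_inv n 0 = 0\<close>, this is the limit of the difference quotients at 0.
  Substituting \<open>1 / x\<close> for \<open>x\<close> turns the limit from the right into a power
  divided by \<open>exp\<close> at infinity.\<close>

lemma exp_inv_at_0:
  "((\<lambda>x. exp_inv n x / x) \<longlongrightarrow> 0) (at 0)"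
proof -
  have "((\<lambda>x::real. x ^ Suc n / exp x) \<longlongrightarrow> 0) at_top"
    by (rule tendsto_power_div_exp_0)
  then have "((\<lambda>x::real. (inverse x) ^ Suc n / exp (inverse x)) \<longlongrightarrow> 0) (at_right 0)"
    by (rule filterlim_compose[OF _ filterlim_inverse_at_top_right])
  then have "((\<lambda>x. exp_inv n x / x) \<longlongrightarrow> 0) (at_right 0)"
    by (rule Lim_transform_eventually)
      (auto simp: exp_inv_def eventually_at_right_field exp_minus field_simps intro!: exI[of _ 1])
  moreover have "((\<lambda>x. exp_inv n x / x) \<longlongrightarrow> 0) (at_left 0)"
    by (rule tendsto_eventually) (auto simp: exp_inv_def eventually_at_left_field intro!: exI[of _ "-1"])
  ultimately show ?thesis
    by (simp add: filterlim_split_at)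
qed

lemma exp_inv_deriv:
  "(exp_inv n has_real_derivative exp_inv (n + 2) x - real n * exp_inv (n + 1) x) (at x)"
proof -
  consider "x > 0" | "x < 0" | "x = 0" by linarith
  then show ?thesis
  proof cases
    case 1
    have "((\<lambda>x. (1 / x) ^ n * exp (- 1 / x)) has_real_derivative
            exp_inv (n + 2) x - real n * exp_inv (n + 1) x) (at x)"
    proof (cases n)
      case 0
      then show ?thesis
        using 1 by (auto intro!: derivative_eq_intros simp: exp_inv_def power2_eq_square)
    next
      case (Suc m)
      have "((\<lambda>x. (1 / x) ^ n * exp (- 1 / x)) has_real_derivative
          (real n * (1 / x) ^ (n - 1) * (- 1 / (x * x))) * exp (- 1 / x) +
          (1 / x) ^ n * (exp (- 1 / x) * (1 / (x * x)))) (at x)"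
        using 1 by (auto intro!: derivative_eq_intros)
      then show ?thesis
        by (rule DERIV_cong) (use 1 Suc in \<open>simp add: exp_inv_def field_simps\<close>)
    qed
    then show ?thesis
      by (rule has_field_derivative_transform_within_open[where S = "{0<..}"])
        (use 1 in \<open>auto simp: exp_inv_def\<close>)
  next
    case 2
    have "((\<lambda>x. 0) has_real_derivative exp_inv (n + 2) x - real n * exp_inv (n + 1) x) (at x)"
      using 2 by (simp add: exp_inv_def)
    then show ?thesis
      by (rule has_field_derivative_transform_within_open[where S = "{..<0}"])
        (use 2 in \<open>auto simp: exp_inv_def\<close>)
  next
    case 3
    then show ?thesis
      using exp_inv_at_0[of n] by (simp add: has_field_derivative_iff exp_inv_def)
  qed
qed

text \<open>A set of functions closed under taking derivatives. Membership alone therefore yields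
  smoothness, without any formula for higher derivatives.\<close>

inductive_set bump_span :: "(real \<Rightarrow> real) set" where
  base: "(\<lambda>x. c * (exp_inv m (x - a) * exp_inv n (b - x))) \<in> bump_span"
| add: "f \<in> bump_span \<Longrightarrow> g \<in> bump_span \<Longrightarrow> (\<lambda>x. f x + g x) \<in> bump_span"

lemma bump_span_has_deriv:
  assumes "f \<in> bump_span"
  obtains f' where "f' \<in> bump_span" "\<And>x. (f has_real_derivative f' x) (at x)"
proof -
  from assms have "\<exists>f'\<in>bump_span. \<forall>x. (f has_real_derivative f' x) (at x)"
  proof induction
    case (base c m a n b)
    let ?u = "\<lambda>c m n x. c * (exp_inv m (x - a) * exp_inv n (b - x))"
    let ?g = "\<lambda>x. (?u c (m + 2) n x + ?u (- c * m) (m + 1) n x) +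
                  (?u (- c) m (n + 2) x + ?u (c * n) m (n + 1) x)"
    have "(?u c m n has_real_derivative ?g x) (at x)" for x
    proof -
      have 1: "((\<lambda>x. exp_inv m (x - a)) has_real_derivative
              exp_inv (m + 2) (x - a) - real m * exp_inv (m + 1) (x - a)) (at x)"
        by (rule DERIV_cong[OF DERIV_chain2[OF exp_inv_deriv]]) (auto intro!: derivative_eq_intros)
      have 2: "((\<lambda>x. exp_inv n (b - x)) has_real_derivative
              - (exp_inv (n + 2) (b - x) - real n * exp_inv (n + 1) (b - x))) (at x)"
        by (rule DERIV_cong[OF DERIV_chain2[OF exp_inv_deriv]]) (auto intro!: derivative_eq_intros)
      show ?thesis
        by (rule DERIV_cong[OF DERIV_cmult[OF DERIV_mult[OF 1 2]]]) (simp add: algebra_simps)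
    qed
    moreover have "?g \<in> bump_span"
      by (intro bump_span.intros)
    ultimately show ?case
      by (intro bexI[of _ ?g] allI)
  next
    case (add f g)
    then obtain f' g' where "f' \<in> bump_span" "g' \<in> bump_span"
      "\<And>x. (f has_real_derivative f' x) (at x)" "\<And>x. (g has_real_derivative g' x) (at x)" by metis
    then show ?case
      by (intro bexI[of _ "\<lambda>x. f' x + g' x"] allI DERIV_add bump_span.add)
  qed
  then show ?thesis using that by blast
qed

lemma bump_span_higher_deriv:
  assumes "f \<in> bump_span"
  shows "(deriv ^^ k) f \<in> bump_span"
proof (induction k)
  case (Suc k)
  then obtain f' where "f' \<in> bump_span" "\<And>x. ((deriv ^^ k) f has_real_derivative f' x) (at x)"
    using bump_span_has_deriv by blast
  moreover from this have "deriv ((deriv ^^ k) f) = f'"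
    by (intro ext DERIV_imp_deriv)
  ultimately show ?case by simp
qed (use assms in simp)

lemma bump_span_differentiable:
  assumes "f \<in> bump_span"
  shows "f differentiable (at x)"
  by (rule bump_span_has_deriv[OF assms]) (auto simp: real_differentiable_def)

text \<open>A smooth function, positive exactly on the open interval with centre \<open>c\<close>
  and radius \<open>r\<close>.\<close>

definition bump :: "real \<Rightarrow> real \<Rightarrow> real \<Rightarrow> real" where
  "bump c r x = exp_inv 0 (x - (c - r)) * exp_inv 0 (c + r - x)"

lemma bump_continuous: "continuous_on A (bump c r)"
proof -
  have "(\<lambda>x. 1 * (exp_inv 0 (x - (c - r)) * exp_inv 0 (c + r - x))) \<in> bump_span"
    by (rule bump_span.base)
  then have "bump c r \<in> bump_span"
    by (simp add: bump_def[abs_def])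
  then have "\<And>x. isCont (bump c r) x"
    by (metis bump_span_differentiable differentiable_imp_continuous_within)
  then show ?thesis
    by (simp add: continuous_at_imp_continuous_on)
qed

lemma bump_nonneg: "0 \<le> bump c r x"
  by (simp add: bump_def exp_inv_nonneg)

lemma bump_eq_0: "r \<le> \<bar>x - c\<bar> \<Longrightarrow> bump c r x = 0"
  by (auto simp: bump_def exp_inv_def)

lemma bump_pos: "\<bar>x - c\<bar> < r \<Longrightarrow> 0 < bump c r x"
  unfolding bump_def by (intro mult_pos_pos exp_inv_pos) auto

lemma bump_shift: "bump c r x = bump 0 r (x - c)"
  by (simp add: bump_def algebra_simps)

text \<open>Translated bumps have the same integral, so the antiderivative of their difference has
  compact support. Values at the end points are recorded for integration by parts.\<close>

lemma bump_difference_test_function: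
  assumes "0 < a - r" "a < b" "b + r < T" "0 < r"
  obtains \<phi> where "test_function T \<phi>"
    "\<And>x. (\<phi> has_real_derivative bump a r x - bump b r x) (at x)"
    "\<phi> 0 = 0" "\<phi> T = 0"
proof -
  \<comment> \<open>For \<open>x < - r\<close> the interval is empty and the integral is 0, the
    correct value since the bump vanishes there.\<close>
  define H where "H x = integral {- r..x} (bump 0 r)" for x
  have H0: "H x = 0" if "x \<le> - r" for x
  proof (cases "x = - r")
    case False
    then show ?thesis using that by (simp add: H_def)
  qed (simp add: H_def)
  have dH: "(H has_real_derivative bump 0 r x) (at x)" for x
  proof (cases "x \<le> - r")
    case False
    have "(H has_real_derivative bump 0 r x) (at x within {- r..x + 1})"
      unfolding H_def
      by (rule integral_has_real_derivative) (use False in \<open>auto intro: bump_continuous\<close>)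
    then show ?thesis
      using at_within_interior[of x "{- r..x + 1}"] False by (simp add: interior_atLeastAtMost_real)
  next
    case True
    show ?thesis
    proof (cases "x = - r")
      case False
      have "((\<lambda>x. 0) has_real_derivative bump 0 r x) (at x)"
        using True by (simp add: bump_eq_0)
      then show ?thesis
        by (rule has_field_derivative_transform_within_open[where S = "{..<-r}"])
          (use False True in \<open>auto simp: H0\<close>)
    next
      \<comment> \<open>At the left end of the support the two one-sided derivatives, both 0, are
        glued together.\<close>
      case eq: True
      have r: "(H has_real_derivative bump 0 r x) (at x within {- r..- r + 1})"
        unfolding H_def
        by (rule integral_has_real_derivative) (use eq in \<open>auto intro: bump_continuous\<close>)
      have l: "(H has_real_derivative bump 0 r x) (at x within {..- r})"
      proof (rule has_field_derivative_transform_within[where d = 1 and f = "\<lambda>_. 0"])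
        show "((\<lambda>_. 0) has_real_derivative bump 0 r x) (at x within {..- r})"
          using eq \<open>0 < r\<close> by (simp add: bump_eq_0)
      qed (use eq H0 in auto)
      have "(H has_real_derivative bump 0 r x) (at x within {..- r} \<union> {- r..- r + 1})"
        using l r by (auto simp: has_field_derivative_iff Lim_within_Un)
      moreover have "x \<in> interior ({..- r} \<union> {- r..- r + 1})"
        by (rule interiorI[of "{..<- r + 1}"]) (use eq in auto)
      ultimately show ?thesis
        by (metis at_within_interior)
    qed
  qed
  have Hconst: "H x = H r" if "x \<ge> r" for x
  proof (cases "x = r")
    case False
    have "H x = integral {- r..r} (bump 0 r) + integral {r..x} (bump 0 r)"
      unfolding H_def using that \<open>0 < r\<close>
      by (intro Henstock_Kurzweil_Integration.integral_combine[symmetric]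
          integrable_continuous_real bump_continuous) auto
    moreover have "integral {r..x} (bump 0 r) = integral {r..x} (\<lambda>_. 0)"
      by (rule integral_cong) (use \<open>0 < r\<close> in \<open>auto simp: bump_eq_0\<close>)
    ultimately show ?thesis by (simp add: H_def)
  qed simp
  \<comment> \<open>To the right of both supports the two copies of \<open>H\<close> take the same
    constant value and cancel.\<close>
  define \<phi> where "\<phi> x = H (x - a) - H (x - b)" for x
  have d: "(\<phi> has_real_derivative bump a r x - bump b r x) (at x)" for x
  proof -
    have "((\<lambda>x. H (x - c)) has_real_derivative bump c r x) (at x)" for c
      unfolding bump_shift[of c]
      by (rule DERIV_cong[OF DERIV_chain2[OF dH]]) (auto intro!: derivative_eq_intros)
    then show ?thesis unfolding \<phi>_def by (intro DERIV_diff)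
  qed
  have "bump a r x - bump b r x = 1 * (exp_inv 0 (x - (a - r)) * exp_inv 0 (a + r - x)) +
      (- 1) * (exp_inv 0 (x - (b - r)) * exp_inv 0 (b + r - x))" for x
    by (simp add: bump_def)
  then have "(\<lambda>x. bump a r x - bump b r x) \<in> bump_span"
    by (simp only:) (intro bump_span.intros)
  moreover have "deriv \<phi> = (\<lambda>x. bump a r x - bump b r x)"
    using d by (intro ext DERIV_imp_deriv)
  ultimately have "deriv \<phi> \<in> bump_span" by simp
  then have "((deriv ^^ k) \<phi>) differentiable (at x)" for k x
  proof (cases k)
    case 0
    then show ?thesis using d real_differentiable_def by auto
  next
    case (Suc l)
    then show ?thesis
      using bump_span_differentiable[OF bump_span_higher_deriv[OF \<open>deriv \<phi> \<in> bump_span\<close>, of l], of x]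
      by (simp add: funpow_Suc_right del: funpow.simps)
  qed
  moreover have z: "\<phi> x = 0" if "x \<notin> {a - r..b + r}" for x
  proof -
    have "x - a \<le> - r \<and> x - b \<le> - r \<or> x - a \<ge> r \<and> x - b \<ge> r"
      using that assms by auto
    then show ?thesis
      unfolding \<phi>_def using H0[of "x - a"] H0[of "x - b"] Hconst[of "x - a"] Hconst[of "x - b"]
      by (elim disjE) auto
  qed
  then have "{x. \<phi> x \<noteq> 0} \<subseteq> {a - r..b + r}"
    by blast
  then have "closure {x. \<phi> x \<noteq> 0} \<subseteq> {a - r..b + r}"
    by (intro closure_minimal) auto
  ultimately have "test_function T \<phi>"
    unfolding test_function_def using assms by fastforce
  moreover have "\<phi> 0 = 0" "\<phi> T = 0"
    using assms by (auto intro!: z)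
  ultimately show ?thesis using d that by blast
qed

section \<open>Continuous weak derivatives are classical\<close>

lemma set_integral_open_interval:
  fixes f :: "real \<Rightarrow> real"
  assumes "continuous_on {a..b} f"
  shows "set_integrable lborel {a<..<b} f" "(LBINT t:{a<..<b}. f t) = integral {a..b} f"
proof -
  show i: "set_integrable lborel {a<..<b} f"
    by (rule set_integrable_subset[OF borel_integrable_atLeastAtMost'[OF assms]]) auto
  show "(LBINT t:{a<..<b}. f t) = integral {a..b} f"
    using set_borel_integral_eq_integral(2)[OF i] by (simp add: integral_open_interval_real)
qed

text \<open>The du Bois-Reymond lemma: \<open>w\<close>, which is \<open>u\<close> minus the
  integral of \<open>f\<close>, is orthogonal to derivatives of test functions. If it took different
  values at two interior points, testing with a bump at each, of opposite signs, would give a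
  contradiction.\<close>

lemma continuous_weak_deriv:
  assumes u: "continuous_on {0..T} u" and f: "continuous_on {0..T} f" and "0 < T"
    and weak: "has_weak_deriv T u g" and ae: "AE t in lborel. t \<in> {0<..<T} \<longrightarrow> g t = f t"
    and t: "t \<in> {0..T}"
  shows "u t = u 0 + integral {0..t} f"
proof -
  define W where "W t = integral {0..t} f" for t
  have dW: "(W has_real_derivative f t) (at t within {0..T})" if "t \<in> {0..T}" for t
    unfolding W_def by (rule integral_has_real_derivative[OF f that])
  then have cW: "continuous_on {0..T} W"
    by (meson DERIV_continuous_on)
  define w where "w t = u t - W t" for t
  have cw: "continuous_on {0..T} w"
    unfolding w_def by (intro continuous_intros u cW)
  \<comment> \<open>The weak identity for \<open>u\<close> is compared with integration by parts for
    \<open>W + m\<close>. The constant \<open>m\<close> is free, since the two bumps have equal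
    integrals.\<close>
  have orth: "integral {0..T} (\<lambda>t. (bump a r t - bump b r t) * (w t - m)) = 0"
    if r: "0 < a - r" "a < b" "b + r < T" "0 < r" for a b r m
  proof -
    from bump_difference_test_function[OF r] obtain \<phi> where \<phi>: "test_function T \<phi>"
      "\<And>x. (\<phi> has_real_derivative bump a r x - bump b r x) (at x)" "\<phi> 0 = 0" "\<phi> T = 0"
      by blast
    define \<eta> where "\<eta> x = bump a r x - bump b r x" for x
    have c\<eta>: "continuous_on A \<eta>" for A
      unfolding \<eta>_def by (intro continuous_intros bump_continuous)
    have d\<phi>: "(\<phi> has_real_derivative \<eta> x) (at x within A)" for x A
      using \<phi>(2) unfolding \<eta>_def by (rule has_field_derivative_at_within)
    then have c\<phi>: "continuous_on A \<phi>" for A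
      by (meson DERIV_continuous_on)
    have deriv: "deriv \<phi> = \<eta>"
      using d\<phi> by (intro ext DERIV_imp_deriv)
    have gm: "(\<lambda>t. indicator {0<..<T} t *\<^sub>R g t) \<in> borel_measurable lborel"
      using weak unfolding has_weak_deriv_def set_integrable_def by (blast dest: borel_measurable_integrable)
    have \<phi>m: "\<phi> \<in> borel_measurable lborel"
      using borel_measurable_continuous_onI[OF c\<phi>[of UNIV]] by simp
    have "set_integrable lborel {0<..<T} (\<lambda>t. f t * \<phi> t)"
      by (intro set_integral_open_interval continuous_intros f c\<phi>)
    then have fm: "(\<lambda>t. indicator {0<..<T} t *\<^sub>R (f t * \<phi> t)) \<in> borel_measurable lborel"
      unfolding set_integrable_def by (rule borel_measurable_integrable)
    have "(LBINT t:{0<..<T}. g t * \<phi> t) = (LBINT t:{0<..<T}. f t * \<phi> t)"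
      unfolding set_lebesgue_integral_def
    proof (rule integral_cong_AE)
      show "(\<lambda>t. indicator {0<..<T} t *\<^sub>R (g t * \<phi> t)) \<in> borel_measurable lborel"
        using borel_measurable_times[OF gm \<phi>m] by (simp add: mult.assoc)
      show "AE t in lborel. indicator {0<..<T} t *\<^sub>R (g t * \<phi> t) = indicator {0<..<T} t *\<^sub>R (f t * \<phi> t)"
        using ae by eventually_elim (auto simp: indicator_def)
    qed (rule fm)
    moreover have "(LBINT t:{0<..<T}. u t * deriv \<phi> t) = - (LBINT t:{0<..<T}. g t * \<phi> t)"
      using weak \<phi>(1) unfolding has_weak_deriv_def by blast
    ultimately have "integral {0..T} (\<lambda>t. u t * \<eta> t) = - integral {0..T} (\<lambda>t. f t * \<phi> t)"
      unfolding deriv using u f c\<phi> c\<eta>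
      by (simp add: set_integral_open_interval continuous_on_mult)
    moreover have "integral {0..T} (\<lambda>t. \<eta> t * (W t + m) + f t * \<phi> t) = 0"
    proof -
      have "((\<lambda>t. \<phi> t * (W t + m)) has_real_derivative \<eta> t * (W t + m) + f t * \<phi> t)
          (at t within {0..T})" if "t \<in> {0..T}" for t
        by (rule DERIV_cong[OF DERIV_mult[OF d\<phi> DERIV_add[OF dW[OF that] DERIV_const]]]) simp
      then have "((\<lambda>t. \<eta> t * (W t + m) + f t * \<phi> t) has_integral
          \<phi> T * (W T + m) - \<phi> 0 * (W 0 + m)) {0..T}"
        using \<open>0 < T\<close> by (intro fundamental_theorem_of_calculus)
          (auto simp: has_real_derivative_iff_has_vector_derivative)
      then show ?thesis
        using \<phi>(3,4) by (simp add: integral_unique)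
    qed
    moreover have "integral {0..T} (\<lambda>t. \<eta> t * (W t + m) + f t * \<phi> t) =
        integral {0..T} (\<lambda>t. \<eta> t * (W t + m)) + integral {0..T} (\<lambda>t. f t * \<phi> t)"
      by (intro Henstock_Kurzweil_Integration.integral_add integrable_continuous_real continuous_intros c\<eta> cW f c\<phi>)
    moreover have "integral {0..T} (\<lambda>t. u t * \<eta> t - \<eta> t * (W t + m)) =
        integral {0..T} (\<lambda>t. u t * \<eta> t) - integral {0..T} (\<lambda>t. \<eta> t * (W t + m))"
      by (intro Henstock_Kurzweil_Integration.integral_diff integrable_continuous_real continuous_intros c\<eta> cW u)
    moreover have "(\<lambda>t. u t * \<eta> t - \<eta> t * (W t + m)) = (\<lambda>t. (bump a r t - bump b r t) * (w t - m))"
      by (auto simp: \<eta>_def w_def algebra_simps)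
    ultimately show ?thesis by simp
  qed
  have eq: "w a = w b" if ab: "0 < a" "a < b" "b < T" for a b
  proof (rule ccontr)
    assume ne: "w a \<noteq> w b"
    \<comment> \<open>With the midpoint subtracted, \<open>d * (w - m)\<close> is positive near
      \<open>a\<close> and negative near \<open>b\<close>. Multiplied by the difference of the bumps
      it becomes nonnegative, so its zero integral forces it to vanish.\<close>
    define m where "m = (w a + w b) / 2"
    define d where "d = w a - w b"
    have "d \<noteq> 0" using ne by (simp add: d_def)
    have cont: "((\<lambda>t. d * (w t - m)) \<longlongrightarrow> d * (w s - m)) (nhds s)" if "0 < s" "s < T" for s
    proof -
      have "isCont w s"
        using continuous_on_interior[OF cw, of s] that by (simp add: interior_atLeastAtMost_real)
      then show ?thesis by (intro tendsto_intros) (simp add: isCont_def tendsto_at_iff_tendsto_nhds)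
    qed
    have wab: "w a - m = d / 2" "w b - m = - (d / 2)"
      by (auto simp: m_def d_def field_simps)
    have dd: "0 < d * d"
      using \<open>d \<noteq> 0\<close> by (simp add: zero_less_mult_iff) linarith
    have pa: "d * (w a - m) > 0" and pb: "d * (w b - m) < 0"
      unfolding wab using dd by simp_all
    have "eventually (\<lambda>t. d * (w t - m) > 0) (nhds a)"
      by (rule order_tendstoD(1)[OF cont pa]) (use ab in auto)
    then obtain r1 where r1: "r1 > 0" "\<And>t. \<bar>t - a\<bar> < r1 \<Longrightarrow> d * (w t - m) > 0"
      unfolding eventually_nhds_metric dist_real_def by blast
    have "eventually (\<lambda>t. d * (w t - m) < 0) (nhds b)"
      by (rule order_tendstoD(2)[OF cont pb]) (use ab in auto)
    then obtain r2 where r2: "r2 > 0" "\<And>t. \<bar>t - b\<bar> < r2 \<Longrightarrow> d * (w t - m) < 0"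
      unfolding eventually_nhds_metric dist_real_def by blast
    \<comment> \<open>Small enough that both signs persist, both supports lie inside
      \<open>(0, T)\<close>, and the supports do not overlap.\<close>
    define r where "r = min (min r1 r2) (min (a / 2) (min ((T - b) / 2) ((b - a) / 2)))"
    have "0 < r"
      unfolding r_def using r1(1) r2(1) ab by simp
    moreover have "r \<le> r1" "r \<le> r2" "r \<le> a / 2" "r \<le> (T - b) / 2" "r \<le> (b - a) / 2"
      unfolding r_def by linarith+
    ultimately have r: "0 < r" "r \<le> r1" "r \<le> r2" "r \<le> a / 2" "r \<le> (T - b) / 2" "r \<le> (b - a) / 2"
      by simp_all
    let ?F = "\<lambda>t. (bump a r t - bump b r t) * (d * (w t - m))"
    have "integral {0..T} (\<lambda>t. d * ((bump a r t - bump b r t) * (w t - m))) = 0"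
      using orth[of a r b m] r ab by simp
    then have "integral {0..T} ?F = 0"
      by (simp add: mult.left_commute)
    moreover have "continuous_on {0..T} ?F"
      by (intro continuous_intros bump_continuous cw)
    moreover have "?F t \<ge> 0" for t
    proof -
      consider "\<bar>t - a\<bar> < r" | "\<bar>t - b\<bar> < r" | "\<bar>t - a\<bar> \<ge> r" "\<bar>t - b\<bar> \<ge> r" by linarith
      then show ?thesis
      proof cases
        case 1
        then have "t - a < r" by (simp add: abs_less_iff)
        then have "r \<le> b - t" using r(6) by (simp add: field_simps)
        then have "\<bar>t - b\<bar> \<ge> r" by linarith
        then show ?thesis
          using 1 r1(2)[of t] r bump_nonneg[of a r t] by (simp add: bump_eq_0)
      next
        case 2
        then have "b - t < r" by (simp add: abs_less_iff)
        then have "r \<le> t - a" using r(6) by (simp add: field_simps)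
        then have "\<bar>t - a\<bar> \<ge> r" by linarith
        then show ?thesis
          using 2 r2(2)[of t] r bump_nonneg[of b r t]
          by (simp add: bump_eq_0 mult_nonneg_nonpos)
      qed (simp add: bump_eq_0)
    qed
    ultimately have "?F a = 0"
      using integral_eq_0_iff[of 0 T ?F] ab by auto
    moreover have "bump b r a = 0" using r by (intro bump_eq_0) auto
    moreover have "bump a r a > 0" using r by (intro bump_pos) auto
    ultimately show False using pa by auto
  qed
  have mid: "w t = w (T / 2)" if "t \<in> {0<..<T}" for t
  proof (cases t "T / 2" rule: linorder_cases)
    case less
    show ?thesis by (rule eq) (use less that in auto)
  next
    case greater
    show ?thesis by (rule eq[symmetric]) (use greater that in auto)
  next
    case equal
    then show ?thesis by (rule arg_cong)
  qed
  have closure: "closure {0<..<T} = {0..T}" using \<open>0 < T\<close> by simp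
  have const: "w t = w (T / 2)" if "t \<in> {0..T}" for t
    by (rule continuous_constant_on_closure[of "{0<..<T}" w])
      (simp only: closure cw, erule mid, simp only: closure that)
  have "w t = w 0"
    by (rule trans[OF const const[symmetric]]) (use t \<open>0 < T\<close> in auto)
  then show ?thesis
    by (simp add: w_def W_def)
qed

lemma weak_deriv_imp_has_real_derivative:
  assumes u: "continuous_on {0..} u" and f: "continuous_on {0..} f"
    and weak: "\<And>T. 0 < T \<Longrightarrow> \<exists>g. has_weak_deriv T u g \<and>
      (AE t in lborel. t \<in> {0<..<T} \<longrightarrow> g t = f t)"
    and "0 \<le> t"
  shows "(u has_real_derivative f t) (at t within {0..})"
proof -
  \<comment> \<open>Leaves room to the right of \<open>t\<close>, so that \<open>{0..T}\<close> and
    \<open>{0..}\<close> give the same filter at \<open>t\<close>, also for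
    \<open>t = 0\<close>.\<close>
  define T where "T = t + 1"
  have "0 < T" using \<open>0 \<le> t\<close> by (simp add: T_def)
  obtain g where g: "has_weak_deriv T u g" "AE t in lborel. t \<in> {0<..<T} \<longrightarrow> g t = f t"
    using weak[OF \<open>0 < T\<close>] by blast
  have cu: "continuous_on {0..T} u" and cf: "continuous_on {0..T} f"
    using u f by (auto elim: continuous_on_subset)
  have "((\<lambda>t. u 0 + integral {0..t} f) has_real_derivative f t) (at t within {0..T})"
    using integral_has_real_derivative[OF cf, of t] \<open>0 \<le> t\<close>
    by (auto intro!: derivative_eq_intros simp: T_def)
  then have "(u has_real_derivative f t) (at t within {0..T})"
    by (rule has_field_derivative_transform_within[of _ _ _ _ 1])
      (use \<open>0 \<le> t\<close> in \<open>auto simp: T_def intro!: continuous_weak_deriv[OF cu cf \<open>0 < T\<close> g, symmetric]\<close>)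
  moreover have "at t within {0..T} = at t within {0..}"
    by (rule at_within_nhd[of t "{..<T}"]) (auto simp: T_def)
  ultimately show ?thesis by simp
qed

section \<open>Odd powers, definite forms and Dini derivatives\<close>

text \<open>Reduces continuity and monotonicity of the odd power to those of \<open>powr\<close> on
  nonnegative arguments.\<close>

lemma odd_pow_conv_max: "0 < p \<Longrightarrow> odd_pow x p = max x 0 powr p - max (- x) 0 powr p"
  by (auto simp: odd_pow_def sgn_if max_def)

lemma continuous_on_odd_pow:
  assumes "continuous_on A f" "0 < p"
  shows "continuous_on A (\<lambda>x. odd_pow (f x) p)"
  unfolding odd_pow_conv_max[OF \<open>0 < p\<close>] using assms
  by (intro continuous_on_diff continuous_on_powr' continuous_intros) auto

lemma odd_pow_mono: "0 < p \<Longrightarrow> x \<le> y \<Longrightarrow> odd_pow x p \<le> odd_pow y p"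
  unfolding odd_pow_conv_max by (intro diff_mono powr_mono2) auto

lemma odd_pow_monotone_product: "0 < p \<Longrightarrow> 0 \<le> (odd_pow x p - odd_pow y p) * (x - y)"
  using odd_pow_mono[of p x y] odd_pow_mono[of p y x]
  by (cases "x \<le> y") (auto simp: mult_nonpos_nonpos)

lemma odd_pow_scale: "0 < c \<Longrightarrow> odd_pow (c * x) p = c powr p * odd_pow x p"
  by (simp add: odd_pow_def sgn_mult abs_mult powr_mult)

lemma odd_pow_inverse: "s \<noteq> 0 \<Longrightarrow> odd_pow (odd_pow x s) (1 / s) = x"
  by (auto simp: odd_pow_def sgn_mult abs_mult powr_powr sgn_if)

lemma mult_odd_pow: "x * odd_pow x p = \<bar>x\<bar> powr (p + 1)"
  by (auto simp: odd_pow_def sgn_if powr_add)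

text \<open>At 0 the difference quotient is \<open>odd_pow x p\<close> itself, which tends to 0.
  This makes the mass differentiable even at times when the odd power is not.\<close>

lemma has_derivative_abs_powr:
  assumes "0 < p"
  shows "((\<lambda>x. \<bar>x\<bar> powr (p + 1)) has_real_derivative (p + 1) * odd_pow x p) (at x)"
proof -
  consider "x > 0" | "x < 0" | "x = 0" by linarith
  then show ?thesis
  proof cases
    case 1
    then have "((\<lambda>x. x powr (p + 1)) has_real_derivative (p + 1) * odd_pow x p) (at x)"
      by (auto intro!: derivative_eq_intros simp: odd_pow_def)
    then show ?thesis
      by (rule has_field_derivative_transform_within_open[where S = "{0<..}"]) (use 1 in auto)
  next
    case 2
    then have "((\<lambda>x. (- x) powr (p + 1)) has_real_derivative (p + 1) * odd_pow x p) (at x)"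
      by (auto intro!: derivative_eq_intros simp: odd_pow_def)
    then show ?thesis
      by (rule has_field_derivative_transform_within_open[where S = "{..<0}"]) (use 2 in auto)
  next
    case 3
    have "isCont (\<lambda>x. odd_pow x p) 0"
      using continuous_on_odd_pow[OF continuous_on_id[of UNIV] assms]
      by (simp add: continuous_on_eq_continuous_at)
    then have "((\<lambda>x. odd_pow x p) \<longlongrightarrow> 0) (at 0)"
      by (simp add: isCont_def odd_pow_def)
    then have "((\<lambda>x. \<bar>x\<bar> powr (p + 1) / x) \<longlongrightarrow> 0) (at 0)"
      by (rule Lim_transform_eventually)
        (auto simp: eventually_at mult_odd_pow[symmetric] intro!: exI[of _ 1])
    then show ?thesis
      using 3 by (simp add: has_field_derivative_iff odd_pow_def)
  qed
qed

text \<open>Gaussian elimination by blocks: a form without nontrivial zeros keeps this property on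
  smaller index sets, by extension with 0, so the system on \<open>S\<close> is solvable and one
  pivot remains.\<close>

lemma definite_form_solvable:
  fixes K :: "'a \<Rightarrow> 'a \<Rightarrow> real"
  assumes "finite S"
    and "\<And>f. \<exists>i\<in>S. f i \<noteq> 0 \<Longrightarrow> (\<Sum>i\<in>S. f i * (\<Sum>j\<in>S. K i j * f j)) \<noteq> 0"
  shows "\<exists>b. \<forall>i\<in>S. (\<Sum>j\<in>S. K i j * b j) = a i"
  using assms
proof (induction S arbitrary: a rule: finite_induct)
  case (insert x S)
  have "(\<Sum>i\<in>S. f i * (\<Sum>j\<in>S. K i j * f j)) \<noteq> 0" if "\<exists>i\<in>S. f i \<noteq> 0" for f
  proof -
    let ?f = "\<lambda>i. if i = x then 0 else f i"
    have eq: "i \<in> S \<Longrightarrow> ?f i = f i" for i using insert.hyps by auto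
    have "(\<Sum>i\<in>insert x S. ?f i * (\<Sum>j\<in>insert x S. K i j * ?f j)) \<noteq> 0"
      by (rule insert.prems) (use that insert.hyps in auto)
    then show ?thesis
      using insert.hyps by (simp add: eq cong: sum.cong)
  qed
  note solve = insert.IH[OF this]
  obtain r where r: "\<And>i. i \<in> S \<Longrightarrow> (\<Sum>j\<in>S. K i j * r j) = a i"
    using solve[of a] by blast
  obtain y where y: "\<And>i. i \<in> S \<Longrightarrow> (\<Sum>j\<in>S. K i j * y j) = K i x"
    using solve[of "\<lambda>i. K i x"] by blast
  \<comment> \<open>The Schur complement of the block \<open>S\<close>. It is the value of the form
    at the vector with entry 1 at \<open>x\<close> and \<open>- y\<close> on \<open>S\<close>, since
    \<open>K\<close> maps this vector to 0 on \<open>S\<close>; hence it is nonzero.\<close>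
  define s where "s = K x x - (\<Sum>j\<in>S. K x j * y j)"
  have split: "(\<Sum>j\<in>insert x S. K i j * (if j = x then \<beta> else z j - \<beta> * y j)) =
      K i x * \<beta> + (\<Sum>j\<in>S. K i j * z j) - \<beta> * (\<Sum>j\<in>S. K i j * y j)" for i \<beta> z
  proof -
    have "(\<Sum>j\<in>S. K i j * (if j = x then \<beta> else z j - \<beta> * y j)) =
        (\<Sum>j\<in>S. K i j * z j - \<beta> * (K i j * y j))"
      by (rule sum.cong) (use insert.hyps in \<open>auto simp: algebra_simps\<close>)
    then show ?thesis
      using insert.hyps by (simp add: sum_subtractf sum_distrib_left)
  qed
  have "s \<noteq> 0"
  proof -
    let ?f = "\<lambda>j. if j = x then 1 else 0 - 1 * y j"
    define F where "F i = (\<Sum>j\<in>insert x S. K i j * ?f j)" for i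
    have F: "F i = K i x - (\<Sum>j\<in>S. K i j * y j)" for i
      unfolding F_def split by simp
    have "(\<Sum>i\<in>insert x S. ?f i * F i) \<noteq> 0"
      unfolding F_def by (rule insert.prems) auto
    moreover have "(\<Sum>i\<in>S. ?f i * F i) = 0"
      by (rule sum.neutral) (auto simp: F y)
    ultimately show ?thesis
      using insert.hyps by (simp add: F s_def)
  qed
  define \<beta> where "\<beta> = (a x - (\<Sum>j\<in>S. K x j * r j)) / s"
  have "\<beta> * s = a x - (\<Sum>j\<in>S. K x j * r j)"
    using \<open>s \<noteq> 0\<close> by (simp add: \<beta>_def)
  then have "K x x * \<beta> - \<beta> * (\<Sum>j\<in>S. K x j * y j) = a x - (\<Sum>j\<in>S. K x j * r j)"
    by (simp add: s_def algebra_simps)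
  then have "(\<Sum>j\<in>insert x S. K i j * (if j = x then \<beta> else r j - \<beta> * y j)) = a i"
    if "i \<in> insert x S" for i
    unfolding split by (cases "i = x") (use that in \<open>simp_all add: r y\<close>)
  then show ?case
    by (intro exI[of _ "\<lambda>j. if j = x then \<beta> else r j - \<beta> * y j"] ballI)
qed auto

text \<open>Allow growth at rate \<epsilon>. By compactness there is a last time at which the
  relaxed bound holds, and before \<open>b\<close> the hypothesis would produce a later one.\<close>

lemma antimono_of_dini:
  fixes f :: "real \<Rightarrow> real"
  assumes cont: "continuous_on {a..b} f" and "a \<le> b"
    and dini: "\<And>s \<epsilon>. a \<le> s \<Longrightarrow> s < b \<Longrightarrow> 0 < \<epsilon> \<Longrightarrow> \<exists>t\<in>{s<..b}. f t \<le> f s + \<epsilon> * (t - s)"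
  shows "f b \<le> f a"
proof (rule field_le_epsilon)
  fix \<delta> :: real assume "0 < \<delta>"
  define \<epsilon> where "\<epsilon> = \<delta> / (b - a + 1)"
  have "0 < \<epsilon>" "\<epsilon> * (b - a) \<le> \<delta>"
    using \<open>0 < \<delta>\<close> \<open>a \<le> b\<close> by (auto simp: \<epsilon>_def field_simps)
  define Z where "Z = {t \<in> {a..b}. f t - \<epsilon> * (t - a) \<le> f a}"
  have "closed Z"
    unfolding Z_def by (intro continuous_on_closed_Collect_le continuous_intros cont)
  moreover have "bounded Z"
    by (rule bounded_subset[OF bounded_closed_interval[of a b]]) (auto simp: Z_def)
  ultimately have "compact Z"
    by (simp add: compact_eq_bounded_closed)
  moreover have "a \<in> Z" using \<open>a \<le> b\<close> by (simp add: Z_def)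
  ultimately obtain s where s: "s \<in> Z" "\<And>t. t \<in> Z \<Longrightarrow> t \<le> s"
    using compact_attains_sup[of Z] by blast
  have "s = b"
  proof (rule ccontr)
    assume "s \<noteq> b"
    then obtain t where t: "t \<in> {s<..b}" "f t \<le> f s + \<epsilon> * (t - s)"
      using dini[of s \<epsilon>] s(1) \<open>0 < \<epsilon>\<close> by (auto simp: Z_def)
    then have "t \<in> Z" using s(1) by (auto simp: Z_def algebra_simps)
    then show False using s(2)[of t] t by auto
  qed
  then show "f b \<le> f a + \<delta>"
    using s(1) \<open>\<epsilon> * (b - a) \<le> \<delta>\<close> by (simp add: Z_def)
qed

section \<open>Dual contraction and monotonicity of the quotient\<close>

text \<open>The unknown is \<open>a\<close>, the odd power \<open>q - 1\<close> of the grid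
  function, because it is differentiable in time; the grid function is recovered with
  \<open>p = 1 / (q - 1)\<close>. The derivative at time 0 is one-sided.\<close>

locale doubly_nonlinear_flow =
  fixes S :: "'a set" and K :: "'a \<Rightarrow> 'a \<Rightarrow> real" and p :: real and a :: "real \<Rightarrow> 'a \<Rightarrow> real"
  assumes finite: "finite S"
    and sym: "K i j = K j i"
    and posdef: "\<exists>i\<in>S. f i \<noteq> 0 \<Longrightarrow> 0 < (\<Sum>i\<in>S. f i * (\<Sum>j\<in>S. K i j * f j))"
    and p_pos: "0 < p"
    and flow: "0 \<le> t \<Longrightarrow> i \<in> S \<Longrightarrow>
      ((\<lambda>t. a t i) has_real_derivative - (\<Sum>j\<in>S. K i j * odd_pow (a t j) p)) (at t within {0..})"
begin

section \<open>Mass and energy along the flow\<close>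

definition v :: "real \<Rightarrow> 'a \<Rightarrow> real" where
  "v t i = odd_pow (a t i) p"

definition Kop :: "('a \<Rightarrow> real) \<Rightarrow> 'a \<Rightarrow> real" where
  "Kop f i = (\<Sum>j\<in>S. K i j * f j)"

definition mass :: "real \<Rightarrow> real" where
  "mass t = (\<Sum>i\<in>S. a t i * v t i)"

definition energy :: "real \<Rightarrow> real" where
  "energy t = (\<Sum>i\<in>S. v t i * Kop (v t) i)"

lemma flow_within:
  "0 \<le> t \<Longrightarrow> i \<in> S \<Longrightarrow> ((\<lambda>t. a t i) has_real_derivative - Kop (v t) i) (at t within {0..})"
  using flow by (simp add: Kop_def v_def)

lemma at_within_atLeast: "0 < t \<Longrightarrow> at t within {0..} = at (t::real)"
  by (rule at_within_interior) simp

lemma flow_at: "0 < t \<Longrightarrow> i \<in> S \<Longrightarrow> ((\<lambda>t. a t i) has_real_derivative - Kop (v t) i) (at t)"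
  using flow_within[of t i] by (simp add: at_within_atLeast)

lemma mass_nonneg: "0 \<le> mass t"
  unfolding mass_def v_def mult_odd_pow by (intro sum_nonneg) auto

lemma Kop_adjoint: "(\<Sum>i\<in>S. Kop f i * g i) = (\<Sum>i\<in>S. f i * Kop g i)"
proof -
  have "(\<Sum>i\<in>S. Kop f i * g i) = (\<Sum>i\<in>S. \<Sum>j\<in>S. f j * (K j i * g i))"
    unfolding Kop_def sum_distrib_right using sym by (intro sum.cong) (auto simp: ac_simps)
  also have "\<dots> = (\<Sum>j\<in>S. \<Sum>i\<in>S. f j * (K j i * g i))"
    by (rule sum.swap)
  also have "\<dots> = (\<Sum>i\<in>S. f i * Kop g i)"
    by (simp add: Kop_def sum_distrib_left)
  finally show ?thesis .
qed

lemma energy_nonneg: "0 \<le> energy t"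
proof (cases "\<exists>i\<in>S. v t i \<noteq> 0")
  case True
  then show ?thesis using posdef[of "v t"] by (simp add: energy_def Kop_def)
qed (auto simp: energy_def)

text \<open>The mass is the sum of \<open>\<bar>a\<bar> powr (p + 1)\<close>, so the chain rule is
  applied through \<open>a\<close> and never differentiates \<open>v\<close>.\<close>

lemma mass_has_derivative:
  assumes "0 \<le> t"
  shows "(mass has_real_derivative - (p + 1) * energy t) (at t within {0..})"
proof -
  have "((\<lambda>t. \<Sum>i\<in>S. \<bar>a t i\<bar> powr (p + 1)) has_real_derivative
      (\<Sum>i\<in>S. (p + 1) * v t i * - Kop (v t) i)) (at t within {0..})"
    unfolding v_def
    by (intro DERIV_sum DERIV_chain2[OF has_derivative_abs_powr[OF p_pos]]
        flow_within[OF assms, unfolded v_def])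
  moreover have "(\<Sum>i\<in>S. (p + 1) * v t i * - Kop (v t) i) = - (p + 1) * energy t"
    unfolding energy_def sum_distrib_left by (rule sum.cong) (simp_all add: algebra_simps)
  ultimately show ?thesis
    by (simp add: mass_def[abs_def] v_def mult_odd_pow)
qed

lemma continuous_on_v: "i \<in> S \<Longrightarrow> continuous_on {0..} (\<lambda>t. v t i)"
  unfolding v_def
  by (intro continuous_on_odd_pow p_pos DERIV_continuous_on[OF flow_within]) auto

lemma continuous_on_energy: "continuous_on {0..} energy"
  unfolding energy_def[abs_def] Kop_def by (intro continuous_intros continuous_on_v)

lemma continuous_on_mass: "continuous_on {0..} mass"
  by (intro DERIV_continuous_on[OF mass_has_derivative]) auto

section \<open>The inner product dual to the form of \<open>K\<close>\<close>

definition green :: "'a \<Rightarrow> 'a \<Rightarrow> real" where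
  "green = (SOME G. \<forall>k. \<forall>i\<in>S. (\<Sum>j\<in>S. K i j * G j k) = (if i = k then 1 else 0))"

text \<open>Each column solves the system with a unit vector on the right, so on \<open>S\<close>
  the chosen matrix is the inverse of \<open>K\<close>.\<close>

lemma green: "i \<in> S \<Longrightarrow> (\<Sum>j\<in>S. K i j * green j k) = (if i = k then 1 else 0)"
proof -
  have "\<exists>b. \<forall>i\<in>S. (\<Sum>j\<in>S. K i j * b j) = (if i = k then 1 else 0)" for k
    by (rule definite_form_solvable[OF finite]) (use posdef in force)
  then obtain G' where "\<And>k. \<forall>i\<in>S. (\<Sum>j\<in>S. K i j * G' k j) = (if i = k then 1 else 0)"
    by metis
  then have "\<exists>G. \<forall>k. \<forall>i\<in>S. (\<Sum>j\<in>S. K i j * G j k) = (if i = k then 1 else 0)"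
    by (intro exI[of _ "\<lambda>j k. G' k j"]) auto
  from someI_ex[OF this] show "i \<in> S \<Longrightarrow> ?thesis"
    unfolding green_def by blast
qed

text \<open>The bilinear form of the inverse of \<open>K\<close>; \<open>dual x x\<close> is the
  squared norm dual to the energy norm.\<close>

definition dual :: "('a \<Rightarrow> real) \<Rightarrow> ('a \<Rightarrow> real) \<Rightarrow> real" where
  "dual x y = (\<Sum>i\<in>S. \<Sum>j\<in>S. x i * (green i j * y j))"

lemma dual_cong: "(\<And>i. i \<in> S \<Longrightarrow> x i = x' i) \<Longrightarrow> (\<And>i. i \<in> S \<Longrightarrow> y i = y' i) \<Longrightarrow> dual x y = dual x' y'"
  unfolding dual_def by (intro sum.cong) auto

text \<open>Moving \<open>K\<close> to the second factor by its symmetry cancels it against its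
  inverse. The equation of the flow thus turns pairings in \<open>dual\<close> into plain
  sums.\<close>

lemma dual_Kop: "dual (Kop x) y = (\<Sum>i\<in>S. x i * y i)"
proof -
  have "Kop (\<lambda>j. \<Sum>k\<in>S. green j k * y k) i = y i" if "i \<in> S" for i
  proof -
    have "Kop (\<lambda>j. \<Sum>k\<in>S. green j k * y k) i = (\<Sum>j\<in>S. \<Sum>k\<in>S. K i j * green j k * y k)"
      by (simp add: Kop_def sum_distrib_left mult.assoc)
    also have "\<dots> = (\<Sum>k\<in>S. (\<Sum>j\<in>S. K i j * green j k) * y k)"
      by (subst sum.swap) (simp add: sum_distrib_right)
    also have "\<dots> = (\<Sum>k\<in>S. if i = k then y k else 0)"
      by (rule sum.cong) (auto simp: green that)
    finally show ?thesis using that finite by simp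
  qed
  moreover have "dual (Kop x) y = (\<Sum>i\<in>S. x i * Kop (\<lambda>j. \<Sum>k\<in>S. green j k * y k) i)"
    unfolding Kop_adjoint[symmetric] by (simp add: dual_def sum_distrib_left)
  ultimately show ?thesis by simp
qed

lemma Kop_surj: obtains b where "\<And>i. i \<in> S \<Longrightarrow> Kop b i = x i"
proof -
  have "\<exists>b. \<forall>i\<in>S. (\<Sum>j\<in>S. K i j * b j) = x i"
    by (rule definite_form_solvable[OF finite]) (use posdef in force)
  then show ?thesis using that by (auto simp: Kop_def)
qed

text \<open>Both arguments are written as images under \<open>Kop\<close>, where symmetry of the
  inverse becomes symmetry of \<open>K\<close>.\<close>

lemma dual_commute: "dual x y = dual y x"
proof -
  obtain b c where b: "\<And>i. i \<in> S \<Longrightarrow> Kop b i = x i" and c: "\<And>i. i \<in> S \<Longrightarrow> Kop c i = y i"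
    using Kop_surj[of x] Kop_surj[of y] by metis
  have "dual x y = dual (Kop b) (Kop c)" "dual y x = dual (Kop c) (Kop b)"
    by (auto intro!: dual_cong simp: b c)
  then show ?thesis
    using Kop_adjoint[of c b] by (simp add: dual_Kop mult.commute)
qed

lemma dual_linear_left: "dual (\<lambda>i. \<alpha> * x i + \<beta> * y i) z = \<alpha> * dual x z + \<beta> * dual y z"
  by (simp add: dual_def sum_distrib_left sum.distrib algebra_simps)

lemma dual_linear_right: "dual z (\<lambda>i. \<alpha> * x i + \<beta> * y i) = \<alpha> * dual z x + \<beta> * dual z y"
  using dual_linear_left dual_commute by metis

section \<open>Contraction in the dual norm\<close>

lemma dual_has_derivative:
  assumes "\<And>i. i \<in> S \<Longrightarrow> ((\<lambda>t. D t i) has_real_derivative D' i) (at t within A)"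
  shows "((\<lambda>t. dual (D t) (D t)) has_real_derivative 2 * dual D' (D t)) (at t within A)"
proof -
  have "((\<lambda>t. dual (D t) (D t)) has_real_derivative
      (\<Sum>i\<in>S. \<Sum>j\<in>S. D' i * (green i j * D t j) + (green i j * D' j) * D t i)) (at t within A)"
    unfolding dual_def using assms
    by (intro DERIV_sum DERIV_mult DERIV_cmult) auto
  also have "(\<Sum>i\<in>S. \<Sum>j\<in>S. D' i * (green i j * D t j) + (green i j * D' j) * D t i) =
      dual D' (D t) + dual (D t) D'"
    by (simp add: dual_def sum.distrib ac_simps)
  finally show ?thesis
    using dual_commute[of "D t" D'] by simp
qed

lemma dual_tendsto:
  assumes "\<And>i. i \<in> S \<Longrightarrow> ((\<lambda>t. D t i) \<longlongrightarrow> l i) F"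
  shows "((\<lambda>t. dual (D t) (D t)) \<longlongrightarrow> dual l l) F"
  unfolding dual_def using assms by (intro tendsto_intros) auto

text \<open>In the derivative of the squared dual distance the inverse cancels \<open>K\<close>.
  What remains is minus twice the sum of products of differences of \<open>x\<close>,
  \<open>y\<close> and of their odd powers, and these products are nonnegative by
  monotonicity.\<close>

lemma dual_contraction:
  assumes "s \<le> t"
    and x: "\<And>\<tau> i. s \<le> \<tau> \<Longrightarrow> \<tau> \<le> t \<Longrightarrow> i \<in> S \<Longrightarrow>
      ((\<lambda>t. x t i) has_real_derivative - Kop (\<lambda>j. odd_pow (x \<tau> j) p) i) (at \<tau>)"
    and y: "\<And>\<tau> i. s \<le> \<tau> \<Longrightarrow> \<tau> \<le> t \<Longrightarrow> i \<in> S \<Longrightarrow>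
      ((\<lambda>t. y t i) has_real_derivative - Kop (\<lambda>j. odd_pow (y \<tau> j) p) i) (at \<tau>)"
  shows "dual (\<lambda>i. x t i - y t i) (\<lambda>i. x t i - y t i) \<le> dual (\<lambda>i. x s i - y s i) (\<lambda>i. x s i - y s i)"
proof (rule DERIV_nonpos_imp_nonincreasing[OF \<open>s \<le> t\<close>])
  fix \<tau> assume \<tau>: "s \<le> \<tau>" "\<tau> \<le> t"
  define w where "w j = odd_pow (x \<tau> j) p - odd_pow (y \<tau> j) p" for j
  have "((\<lambda>t. x t i - y t i) has_real_derivative -1 * Kop w i + 0 * Kop w i) (at \<tau>)" if "i \<in> S" for i
    by (rule DERIV_cong[OF DERIV_diff[OF x[OF \<tau> that] y[OF \<tau> that]]])
      (simp add: Kop_def w_def right_diff_distrib sum_subtractf)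
  then have "((\<lambda>t. dual (\<lambda>i. x t i - y t i) (\<lambda>i. x t i - y t i)) has_real_derivative
      2 * dual (\<lambda>i. -1 * Kop w i + 0 * Kop w i) (\<lambda>i. x \<tau> i - y \<tau> i)) (at \<tau>)"
    by (rule dual_has_derivative)
  moreover have "0 \<le> (\<Sum>i\<in>S. w i * (x \<tau> i - y \<tau> i))"
    unfolding w_def by (intro sum_nonneg odd_pow_monotone_product p_pos)
  ultimately show "\<exists>d. ((\<lambda>t. dual (\<lambda>i. x t i - y t i) (\<lambda>i. x t i - y t i)) has_real_derivative d) (at \<tau>) \<and> d \<le> 0"
    unfolding dual_linear_left dual_Kop by (intro exI conjI) auto
qed

text \<open>The vector \<open>z\<close> is the derivative at \<epsilon> = 0 of a family of solutions
  through \<open>a\<close>. The contraction between members of the family and \<open>a\<close> is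
  divided by the square of \<epsilon>, and \<epsilon> tends to 0 from the right.\<close>

lemma scaled_contraction:
  fixes \<alpha> \<beta> s t :: real
  assumes "0 < s" "s \<le> t"
  defines "z \<equiv> \<lambda>\<tau> i. \<alpha> * a \<tau> i - (\<beta> + (p - 1) * \<alpha> * \<tau>) * Kop (v \<tau>) i"
  shows "dual (z t) (z t) \<le> dual (z s) (z s)"
proof -
  \<comment> \<open>The odd power is homogeneous of degree \<open>p\<close>, so scaling values by a
    factor and time by its power \<open>p - 1\<close> preserves the system, as does a shift in
    time.\<close>
  define y where "y \<epsilon> \<tau> i = (1 + \<epsilon> * \<alpha>) * a ((1 + \<epsilon> * \<alpha>) powr (p - 1) * \<tau> + \<beta> * \<epsilon>) i" for \<epsilon> \<tau> i
  define D where "D \<epsilon> \<tau> i = y \<epsilon> \<tau> i - a \<tau> i" for \<epsilon> \<tau> i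
  have lim: "((\<lambda>\<epsilon>. dual (\<lambda>i. D \<epsilon> \<tau> i / \<epsilon>) (\<lambda>i. D \<epsilon> \<tau> i / \<epsilon>)) \<longlongrightarrow> dual (z \<tau>) (z \<tau>)) (at_right 0)"
    if "0 < \<tau>" for \<tau>
  proof (rule dual_tendsto)
    fix i assume "i \<in> S"
    have t: "((\<lambda>\<epsilon>. (1 + \<epsilon> * \<alpha>) powr (p - 1) * \<tau> + \<beta> * \<epsilon>) has_real_derivative
        (p - 1) * \<alpha> * \<tau> + \<beta>) (at 0)"
      by (auto intro!: derivative_eq_intros)
    have "((\<lambda>t. a t i) has_real_derivative - Kop (v \<tau>) i)
        (at ((\<lambda>\<epsilon>. (1 + \<epsilon> * \<alpha>) powr (p - 1) * \<tau> + \<beta> * \<epsilon>) 0))"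
      using flow_at[OF that \<open>i \<in> S\<close>] by simp
    from DERIV_chain2[OF this t]
    have "((\<lambda>\<epsilon>. a ((1 + \<epsilon> * \<alpha>) powr (p - 1) * \<tau> + \<beta> * \<epsilon>) i) has_real_derivative
        - Kop (v \<tau>) i * ((p - 1) * \<alpha> * \<tau> + \<beta>)) (at 0)" .
    then have "((\<lambda>\<epsilon>. y \<epsilon> \<tau> i) has_real_derivative z \<tau> i) (at 0)"
      unfolding y_def z_def by (auto intro!: derivative_eq_intros simp: algebra_simps)
    then have "((\<lambda>\<epsilon>. D \<epsilon> \<tau> i / \<epsilon>) \<longlongrightarrow> z \<tau> i) (at 0)"
      by (simp add: has_field_derivative_iff D_def y_def)
    then show "((\<lambda>\<epsilon>. D \<epsilon> \<tau> i / \<epsilon>) \<longlongrightarrow> z \<tau> i) (at_right 0)"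
      by (rule filterlim_mono) (auto simp: at_le)
  qed
  have "((\<lambda>\<epsilon>. 1 + \<epsilon> * \<alpha>) \<longlongrightarrow> 1 + 0 * \<alpha>) (at_right 0)"
    by (intro tendsto_intros)
  then have ev1: "eventually (\<lambda>\<epsilon>. 0 < 1 + \<epsilon> * \<alpha>) (at_right 0)"
    by (rule order_tendstoD(1)) simp
  \<comment> \<open>Since \<beta> may be negative, \<epsilon> must be small for the transformed time
    to stay positive, where \<open>a\<close> has two-sided derivatives.\<close>
  have "((\<lambda>\<epsilon>. (1 + \<epsilon> * \<alpha>) powr (p - 1) * s + \<beta> * \<epsilon>) \<longlongrightarrow> (1 + 0 * \<alpha>) powr (p - 1) * s + \<beta> * 0) (at_right 0)"
    by (intro tendsto_intros) auto
  then have ev2: "eventually (\<lambda>\<epsilon>. 0 < (1 + \<epsilon> * \<alpha>) powr (p - 1) * s + \<beta> * \<epsilon>) (at_right 0)"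
    by (rule order_tendstoD(1)) (use \<open>0 < s\<close> in simp)
  have "eventually (\<lambda>\<epsilon>. dual (\<lambda>i. D \<epsilon> t i / \<epsilon>) (\<lambda>i. D \<epsilon> t i / \<epsilon>) \<le>
      dual (\<lambda>i. D \<epsilon> s i / \<epsilon>) (\<lambda>i. D \<epsilon> s i / \<epsilon>)) (at_right 0)"
    using ev1 ev2 eventually_at_right_less[of 0]
  proof eventually_elim
    case (elim \<epsilon>)
    define c where "c = 1 + \<epsilon> * \<alpha>"
    have "0 < c" using elim by (simp add: c_def)
    have "((\<lambda>t. y \<epsilon> t i) has_real_derivative - Kop (\<lambda>j. odd_pow (y \<epsilon> \<tau> j) p) i) (at \<tau>)"
      if "s \<le> \<tau>" "\<tau> \<le> t" "i \<in> S" for \<tau> i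
    proof -
      have "c powr (p - 1) * s \<le> c powr (p - 1) * \<tau>"
        using that by (intro mult_left_mono) auto
      then have pos: "0 < c powr (p - 1) * \<tau> + \<beta> * \<epsilon>"
        using elim(2) unfolding c_def by linarith
      have "((\<lambda>t. c powr (p - 1) * t + \<beta> * \<epsilon>) has_real_derivative c powr (p - 1)) (at \<tau>)"
        by (auto intro!: derivative_eq_intros)
      from DERIV_cmult[OF DERIV_chain2[OF flow_at[OF pos \<open>i \<in> S\<close>] this], of c]
      have "((\<lambda>t. y \<epsilon> t i) has_real_derivative
          c * (- Kop (v (c powr (p - 1) * \<tau> + \<beta> * \<epsilon>)) i * c powr (p - 1))) (at \<tau>)"
        by (simp add: y_def c_def)
      moreover have "c * c powr (p - 1) = c powr p"
        using \<open>0 < c\<close> by (simp add: powr_diff)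
      moreover have "Kop (\<lambda>j. odd_pow (y \<epsilon> \<tau> j) p) i = c powr p * Kop (v (c powr (p - 1) * \<tau> + \<beta> * \<epsilon>)) i"
        unfolding Kop_def sum_distrib_left v_def y_def c_def[symmetric]
        by (rule sum.cong) (simp_all add: odd_pow_scale[OF \<open>0 < c\<close>] mult.left_commute)
      ultimately show ?thesis
        by (metis (no_types, lifting) mult.commute mult.left_commute mult_minus_left mult_minus_right)
    qed
    then have "dual (D \<epsilon> t) (D \<epsilon> t) \<le> dual (D \<epsilon> s) (D \<epsilon> s)"
      unfolding D_def using assms
      by (intro dual_contraction) (auto intro!: flow_at[unfolded v_def])
    moreover have "dual (\<lambda>i. D \<epsilon> \<tau> i / \<epsilon>) (\<lambda>i. D \<epsilon> \<tau> i / \<epsilon>) = dual (D \<epsilon> \<tau>) (D \<epsilon> \<tau>) / \<epsilon>\<^sup>2" for \<tau>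
      by (simp add: dual_def sum_divide_distrib power2_eq_square)
    ultimately show ?case
      by (simp add: divide_right_mono)
  qed
  then show ?thesis
    using lim assms by (intro tendsto_le[OF _ lim lim]) auto
qed

section \<open>Monotonicity of the scaled quotient\<close>

definition dual_mass :: "real \<Rightarrow> real" where
  "dual_mass t = dual (a t) (a t)"

lemma dual_mass_has_derivative: "0 < t \<Longrightarrow> (dual_mass has_real_derivative - 2 * mass t) (at t)"
proof -
  assume "0 < t"
  then have "(dual_mass has_real_derivative 2 * dual (\<lambda>i. -1 * Kop (v t) i + 0 * Kop (v t) i) (a t)) (at t)"
    unfolding dual_mass_def[abs_def] by (intro dual_has_derivative) (auto dest: flow_at)
  then show ?thesis
    unfolding dual_linear_left dual_Kop by (simp add: mass_def mult.commute)
qed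

text \<open>Expanding the square in the dual norm, the mixed term is the mass and the last term is
  the energy, both by \<open>dual_Kop\<close>.\<close>

lemma quadratic_antimono:
  fixes \<alpha> \<beta> :: real
  assumes "0 < s" "s \<le> t"
  defines "Q \<equiv> \<lambda>\<tau>. \<alpha>\<^sup>2 * dual_mass \<tau> - 2 * \<alpha> * (\<beta> + (p - 1) * \<alpha> * \<tau>) * mass \<tau>
      + (\<beta> + (p - 1) * \<alpha> * \<tau>)\<^sup>2 * energy \<tau>"
  shows "Q t \<le> Q s"
proof -
  have "dual (\<lambda>i. \<alpha> * a \<tau> i - c * Kop (v \<tau>) i) (\<lambda>i. \<alpha> * a \<tau> i - c * Kop (v \<tau>) i) =
      \<alpha>\<^sup>2 * dual_mass \<tau> - 2 * \<alpha> * c * mass \<tau> + c\<^sup>2 * energy \<tau>" for \<tau> c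
  proof -
    have "dual (\<lambda>i. \<alpha> * a \<tau> i + (- c) * Kop (v \<tau>) i) (\<lambda>i. \<alpha> * a \<tau> i + (- c) * Kop (v \<tau>) i) =
        \<alpha> * (\<alpha> * dual (a \<tau>) (a \<tau>) - c * dual (Kop (v \<tau>)) (a \<tau>))
        - c * (\<alpha> * dual (Kop (v \<tau>)) (a \<tau>) - c * dual (Kop (v \<tau>)) (Kop (v \<tau>)))"
      unfolding dual_linear_left dual_linear_right dual_commute[of "a \<tau>" "Kop (v \<tau>)"] by simp
    also have "\<dots> = \<alpha>\<^sup>2 * dual_mass \<tau> - 2 * \<alpha> * c * mass \<tau> + c\<^sup>2 * energy \<tau>"
      unfolding dual_Kop dual_mass_def[symmetric] mass_def energy_def
      by (simp add: algebra_simps power2_eq_square)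
    finally show ?thesis by simp
  qed
  then show ?thesis
    using scaled_contraction[OF assms(1,2), of \<alpha> \<beta>] unfolding Q_def by simp
qed

text \<open>For \<open>p = 1 / (q - 1)\<close> the exponent is \<open>2 / q\<close>, so this is the
  Rayleigh quotient up to a constant power of \<open>h\<close>.\<close>

definition quotient :: "real \<Rightarrow> real" where
  "quotient t = energy t / mass t powr (2 * p / (p + 1))"

text \<open>The energy need not be differentiable, but \<open>quadratic_antimono\<close> bounds it
  after time \<open>s\<close> by quantities that are. Dividing by the power of the mass gives a
  majorant \<open>H\<close> that touches the quotient at \<open>s\<close> with slope 0.\<close>

lemma quotient_upper_tangent:
  assumes "0 < s" "0 < mass s"
  obtains H d where "(H has_real_derivative 0) (at s)" "H s = quotient s" "0 < d"
    "\<And>t. s \<le> t \<Longrightarrow> t < s + d \<Longrightarrow> quotient t \<le> H t"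
proof -
  \<comment> \<open>Up to a positive factor, the slope of \<open>H\<close> at \<open>s\<close> is
    the square of \<alpha> minus this ratio, so only this choice makes it vanish.\<close>
  define \<alpha> where "\<alpha> = energy s / mass s"
  define \<mu> where "\<mu> = 2 * p / (p + 1)"
  define c where "c t = 1 + (p - 1) * \<alpha> * (t - s)" for t
  define N where "N t = energy s + \<alpha>\<^sup>2 * (dual_mass s - dual_mass t) - 2 * \<alpha> * (mass s - c t * mass t)" for t
  define E where "E t = (c t)\<^sup>2 * mass t powr \<mu>" for t
  define H where "H t = N t / E t" for t
  have \<alpha>: "energy s = \<alpha> * mass s" using assms by (simp add: \<alpha>_def)
  have \<mu>: "\<mu> * (p + 1) = 2 * p" using p_pos by (simp add: \<mu>_def)
  have cs: "c s = 1" by (simp add: c_def)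
  have Ns: "N s = energy s" by (simp add: N_def cs)
  have Es: "E s = mass s powr \<mu>" by (simp add: E_def cs)
  have dm: "(mass has_real_derivative - (p + 1) * energy s) (at s)"
    using mass_has_derivative[of s] assms by (simp add: at_within_atLeast)
  have dc: "(c has_real_derivative (p - 1) * \<alpha>) (at s)"
    unfolding c_def by (auto intro!: derivative_eq_intros)
  have dN: "(N has_real_derivative - 2 * \<alpha> * energy s) (at s)"
    unfolding N_def using dual_mass_has_derivative[OF \<open>0 < s\<close>] dm dc
    by (auto intro!: derivative_eq_intros simp: cs \<alpha> power2_eq_square algebra_simps)
  have dmu: "((\<lambda>t. mass t powr \<mu>) has_real_derivative - 2 * p * \<alpha> * mass s powr \<mu>) (at s)"
  proof -
    have "((\<lambda>t. mass t powr \<mu>) has_real_derivative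
        \<mu> * mass s powr (\<mu> - 1) * (- (p + 1) * energy s)) (at s)"
      using DERIV_fun_powr[OF dm \<open>0 < mass s\<close>, of \<mu>] by simp
    moreover have "mass s powr (\<mu> - 1) * mass s = mass s powr \<mu>"
      using \<open>0 < mass s\<close> by (simp add: powr_diff)
    then have "\<mu> * mass s powr (\<mu> - 1) * (- (p + 1) * energy s) = - (\<mu> * (p + 1)) * \<alpha> * mass s powr \<mu>"
      unfolding \<alpha> by (metis (no_types, opaque_lifting) mult.assoc mult.commute mult_minus_left)
    ultimately show ?thesis unfolding \<mu> by simp
  qed
  have "((\<lambda>t. (c t)\<^sup>2) has_real_derivative 2 * (p - 1) * \<alpha>) (at s)"
    using dc by (auto intro!: derivative_eq_intros simp: cs)
  from DERIV_mult[OF this dmu]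
  have dE: "(E has_real_derivative - 2 * \<alpha> * mass s powr \<mu>) (at s)"
    unfolding E_def by (rule DERIV_cong) (simp add: cs algebra_simps)
  have "(H has_real_derivative (- 2 * \<alpha> * energy s * E s - N s * (- 2 * \<alpha> * mass s powr \<mu>)) / (E s * E s)) (at s)"
    unfolding H_def by (rule DERIV_divide[OF dN dE]) (use \<open>0 < mass s\<close> in \<open>simp add: Es\<close>)
  then have "(H has_real_derivative 0) (at s)"
    by (simp add: Ns Es)
  moreover have "H s = quotient s"
    by (simp add: H_def Ns Es quotient_def \<mu>_def)
  moreover have "eventually (\<lambda>t. 0 < c t) (at s)"
    using order_tendstoD(1)[of c 1 "at s" 0] DERIV_isCont[OF dc] by (simp add: isCont_def cs)
  then obtain d where d: "0 < d" "\<And>t. t \<noteq> s \<Longrightarrow> dist t s < d \<Longrightarrow> 0 < c t"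
    unfolding eventually_at by blast
  moreover have "quotient t \<le> H t" if "s \<le> t" "t < s + d" for t
  proof -
    have "0 < c t"
      using d(2)[of t] that cs by (cases "t = s") (auto simp: dist_real_def)
    have "\<alpha>\<^sup>2 * dual_mass t - 2 * \<alpha> * c t * mass t + (c t)\<^sup>2 * energy t
        \<le> \<alpha>\<^sup>2 * dual_mass s - 2 * \<alpha> * c s * mass s + (c s)\<^sup>2 * energy s"
      \<comment> \<open>This value of \<beta> makes the coefficient of the energy equal to the
        square of \<open>c\<close>, with \<open>c s = 1\<close>.\<close>
      using quadratic_antimono[OF \<open>0 < s\<close> that(1), of \<alpha> "1 - (p - 1) * \<alpha> * s"]
      by (simp add: c_def algebra_simps)
    then have "(c t)\<^sup>2 * energy t \<le> N t"
      unfolding cs N_def by (simp add: algebra_simps)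
    then have "energy t \<le> N t / (c t)\<^sup>2"
      using \<open>0 < c t\<close> by (simp add: pos_le_divide_eq mult.commute)
    then have "energy t / mass t powr \<mu> \<le> N t / (c t)\<^sup>2 / mass t powr \<mu>"
      by (rule divide_right_mono) simp
    then show ?thesis
      by (simp add: quotient_def H_def E_def \<mu>_def)
  qed
  ultimately show ?thesis using that by blast
qed

lemma continuous_on_quotient:
  assumes "A \<subseteq> {0..}" "\<And>t. t \<in> A \<Longrightarrow> 0 < mass t"
  shows "continuous_on A quotient"
  unfolding quotient_def[abs_def] using assms
  by (intro continuous_intros continuous_on_subset[OF continuous_on_energy]
      continuous_on_subset[OF continuous_on_mass]) force+

text \<open>The tangent majorants supply the Dini condition at positive times. The initial time is
  reached by continuity.\<close>

lemma quotient_antimono: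
  assumes "0 \<le> s" "s \<le> t" and pos: "\<And>\<tau>. s \<le> \<tau> \<Longrightarrow> \<tau> \<le> t \<Longrightarrow> 0 < mass \<tau>"
  shows "quotient t \<le> quotient s"
proof -
  have *: "quotient t \<le> quotient r" if "s \<le> r" "0 < r" "r \<le> t" for r
  proof (rule antimono_of_dini[OF _ \<open>r \<le> t\<close>])
    show "continuous_on {r..t} quotient"
      by (rule continuous_on_quotient) (use that pos in auto)
    fix \<tau> \<epsilon> :: real
    assume \<tau>: "r \<le> \<tau>" "\<tau> < t" and "0 < \<epsilon>"
    then have "0 < \<tau>" "0 < mass \<tau>"
      using pos that by auto
    then obtain H d where H: "(H has_real_derivative 0) (at \<tau>)" "H \<tau> = quotient \<tau>" "0 < d"
      "\<And>t. \<tau> \<le> t \<Longrightarrow> t < \<tau> + d \<Longrightarrow> quotient t \<le> H t"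
      by (rule quotient_upper_tangent) (rule that)
    have "((\<lambda>t. (H t - H \<tau>) / (t - \<tau>)) \<longlongrightarrow> 0) (at \<tau>)"
      using H(1) by (simp add: has_field_derivative_iff)
    from order_tendstoD(2)[OF this \<open>0 < \<epsilon>\<close>]
    obtain e where e: "0 < e" "\<And>t. t \<noteq> \<tau> \<Longrightarrow> dist t \<tau> < e \<Longrightarrow> (H t - H \<tau>) / (t - \<tau>) < \<epsilon>"
      unfolding eventually_at by blast
    define m where "m = Min {t - \<tau>, d, e} / 2"
    have m: "0 < m" "m \<le> (t - \<tau>) / 2" "m \<le> d / 2" "m \<le> e / 2"
      using \<tau> H(3) e(1) by (auto simp: m_def)
    have "(H (\<tau> + m) - H \<tau>) / m < \<epsilon>"
      using e(2)[of "\<tau> + m"] m e(1) by (auto simp: dist_real_def)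
    then have "H (\<tau> + m) \<le> H \<tau> + \<epsilon> * m"
      using m(1) by (simp add: divide_less_eq)
    then have "quotient (\<tau> + m) \<le> quotient \<tau> + \<epsilon> * ((\<tau> + m) - \<tau>)"
      using H(4)[of "\<tau> + m"] H(2,3) m by simp
    then show "\<exists>t'\<in>{\<tau><..t}. quotient t' \<le> quotient \<tau> + \<epsilon> * (t' - \<tau>)"
      using m \<tau> by (intro bexI[of _ "\<tau> + m"]) auto
  qed
  show ?thesis
  proof (cases "0 < s \<or> s = t")
    case True
    then show ?thesis using *[of s] assms by auto
  next
    case False
    then have "s = 0" "0 < t" using assms by auto
    have "continuous_on {0..t} quotient"
      by (rule continuous_on_quotient) (use pos \<open>s = 0\<close> in auto)
    then have "(quotient \<longlongrightarrow> quotient 0) (at 0 within {0..t})"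
      using \<open>0 < t\<close> by (auto simp: continuous_on_def)
    then have "(quotient \<longlongrightarrow> quotient 0) (at_right 0)"
      using at_within_Icc_at_right[OF \<open>0 < t\<close>] by simp
    moreover have "eventually (\<lambda>r. quotient t \<le> quotient r) (at_right 0)"
      using eventually_at_right_real[OF \<open>0 < t\<close>] by eventually_elim (use * \<open>s = 0\<close> in auto)
    ultimately show ?thesis
      unfolding \<open>s = 0\<close> by (rule tendsto_lowerbound) simp
  qed
qed

end

section \<open>Decay and extinction\<close>

lemma first_zero:
  fixes m :: "real \<Rightarrow> real"
  assumes "continuous_on {0..} m" "\<And>t. 0 \<le> t \<Longrightarrow> 0 \<le> m t" "0 < m 0" "0 \<le> s" "m s = 0"
  obtains t where "0 < t" "t \<le> s" "m t = 0" "\<And>r. 0 \<le> r \<Longrightarrow> r < t \<Longrightarrow> 0 < m r"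
proof -
  define Z where "Z = {t \<in> {0..s}. m t = 0}"
  have "closed Z"
    unfolding Z_def using assms(1)
    by (intro continuous_closed_preimage_constant) (auto elim: continuous_on_subset)
  moreover have "bounded Z"
    by (rule bounded_subset[OF bounded_closed_interval[of 0 s]]) (auto simp: Z_def)
  ultimately have "compact Z"
    by (simp add: compact_eq_bounded_closed)
  moreover have "s \<in> Z" using assms by (simp add: Z_def)
  ultimately obtain t where t: "t \<in> Z" "\<And>r. r \<in> Z \<Longrightarrow> t \<le> r"
    using compact_attains_inf[of Z] by blast
  show ?thesis
  proof
    show "t \<le> s" "m t = 0" using t(1) by (auto simp: Z_def)
    show "0 < t" using t(1) \<open>0 < m 0\<close> by (cases "t = 0") (auto simp: Z_def)
    show "0 < m r" if "0 \<le> r" "r < t" for r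
      using that t(2)[of r] t(1) assms(2)[of r] by (force simp: Z_def)
  qed
qed

text \<open>The scalar facts behind the bounds: \<open>m\<close> is the norm to the power
  \<open>q\<close>, \<open>E\<close> the squared energy norm, and \<gamma> stands for
  \<open>C powr (- 2)\<close>. \<open>E\<close> and \<open>R\<close> are separate because
  \<open>R\<close> is meaningful only while \<open>m\<close> is positive.\<close>

locale rayleigh_decay =
  fixes q \<gamma> :: real and m E R :: "real \<Rightarrow> real"
  assumes q: "1 < q" and \<gamma>: "0 < \<gamma>"
    and m_nonneg: "\<And>t. 0 \<le> t \<Longrightarrow> 0 \<le> m t"
    and m_0: "0 < m 0"
    and m_deriv: "\<And>t. 0 \<le> t \<Longrightarrow> (m has_real_derivative - (q / (q - 1)) * E t) (at t within {0..})"
    and E_nonneg: "\<And>t. 0 \<le> t \<Longrightarrow> 0 \<le> E t"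
    and E_eq: "\<And>t. 0 \<le> t \<Longrightarrow> 0 < m t \<Longrightarrow> E t = R t * m t powr (2 / q)"
    and R_lower: "\<And>t. 0 \<le> t \<Longrightarrow> 0 < m t \<Longrightarrow> \<gamma> \<le> R t"
    and R_mono: "\<And>s t. 0 \<le> s \<Longrightarrow> s \<le> t \<Longrightarrow> (\<And>\<tau>. s \<le> \<tau> \<Longrightarrow> \<tau> \<le> t \<Longrightarrow> 0 < m \<tau>) \<Longrightarrow> R t \<le> R s"
begin

lemma m_deriv_at: "0 < t \<Longrightarrow> (m has_real_derivative - (q / (q - 1)) * E t) (at t)"
  using m_deriv[of t] at_within_interior[of t "{0..}"] by simp

lemma m_cont: "continuous_on {0..} m"
  by (intro DERIV_continuous_on[OF m_deriv]) auto

lemma m_cont_Icc: "0 \<le> s \<Longrightarrow> continuous_on {s..t} m"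
  by (rule continuous_on_subset[OF m_cont]) auto

lemma m_antimono: "0 \<le> s \<Longrightarrow> s \<le> t \<Longrightarrow> m t \<le> m s"
proof (rule DERIV_nonpos_imp_decreasing_open[of s t m])
  show "\<exists>d. (m has_real_derivative d) (at x) \<and> d \<le> 0" if "0 \<le> s" "s < x" for x
    using m_deriv_at[of x] E_nonneg[of x] q that
    by (intro exI conjI) (auto intro!: mult_nonneg_nonneg divide_nonneg_nonneg)
qed (auto intro: m_cont_Icc)

lemma R_antimono: "0 \<le> s \<Longrightarrow> s \<le> t \<Longrightarrow> 0 < m t \<Longrightarrow> R t \<le> R s"
  using m_antimono by (intro R_mono) (auto intro: less_le_trans)

text \<open>The norm to the power \<open>q - 2\<close>. Its derivative is
  \<open>- (q - 2) / (q - 1) * R\<close>, with no factor of \<open>m\<close> left.\<close>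

definition y :: "real \<Rightarrow> real" where
  "y t = m t powr ((q - 2) / q)"

text \<open>The end point may be the extinction time when \<open>2 < q\<close>, as the exponent in
  \<open>y\<close> is then positive and \<open>y\<close> stays continuous at a zero of
  \<open>m\<close>.\<close>

lemma y_mean_value:
  assumes "0 \<le> s" "s < t" and pos: "\<And>\<tau>. s \<le> \<tau> \<Longrightarrow> \<tau> < t \<Longrightarrow> 0 < m \<tau>" and "0 < m t \<or> 2 < q"
  obtains r where "s < r" "r < t" "y t = y s - (q - 2) / (q - 1) * R r * (t - s)"
proof -
  have "continuous_on {s..t} y"
  proof (cases "2 < q")
    case True
    then show ?thesis
      unfolding y_def[abs_def] using m_nonneg \<open>0 \<le> s\<close>
      by (intro continuous_on_powr' continuous_on_const m_cont_Icc) auto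
  next
    case False
    then have "m \<tau> \<noteq> 0" if "\<tau> \<in> {s..t}" for \<tau>
      using pos[of \<tau>] assms(4) that by (cases "\<tau> = t") auto
    then show ?thesis
      unfolding y_def[abs_def] using \<open>0 \<le> s\<close>
      by (intro continuous_on_powr continuous_on_const m_cont_Icc) auto
  qed
  moreover have dy: "(y has_real_derivative - ((q - 2) / (q - 1)) * R r) (at r)" if "s < r" "r < t" for r
  proof -
    have r: "0 < r" "0 < m r" using that pos[of r] \<open>0 \<le> s\<close> by auto
    have d: "(y has_real_derivative (q - 2) / q * m r powr ((q - 2) / q - 1) * (- (q / (q - 1)) * E r)) (at r)"
      unfolding y_def[abs_def] using DERIV_fun_powr[OF m_deriv_at[OF r(1)] r(2), of "(q - 2) / q"] by simp
    have "(q - 2) / q * m r powr ((q - 2) / q - 1) * (- (q / (q - 1)) * E r) =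
        - ((q - 2) / q * (q / (q - 1))) * R r * (m r powr ((q - 2) / q - 1) * m r powr (2 / q))"
      using E_eq[of r] r by simp
    also have "m r powr ((q - 2) / q - 1) * m r powr (2 / q) = 1"
      using r q by (simp add: powr_add[symmetric] diff_divide_distrib)
    also have "(q - 2) / q * (q / (q - 1)) = (q - 2) / (q - 1)"
      using q by simp
    finally show ?thesis
      using d by (simp only: mult_1_right)
  qed
  ultimately obtain l r where r: "s < r" "r < t" "(y has_real_derivative l) (at r)" "y t - y s = (t - s) * l"
    using MVT[OF \<open>s < t\<close>, of y] real_differentiable_def by metis
  then have "l = - ((q - 2) / (q - 1)) * R r"
    using DERIV_unique dy by blast
  then show ?thesis
    using r that[of r] by (simp add: algebra_simps)
qed

text \<open>Before a first zero, \<open>R \<le> R 0\<close> and \<open>2 / q - 1 \<ge> 0\<close>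
  bound the dissipation by a multiple of \<open>m\<close>. Hence \<open>m\<close> decays at most
  exponentially and cannot reach 0.\<close>

lemma m_pos_of_le_2:
  assumes "q \<le> 2" "0 \<le> t"
  shows "0 < m t"
proof (rule ccontr)
  assume "\<not> 0 < m t"
  then have "m t = 0" using m_nonneg[OF \<open>0 \<le> t\<close>] by simp
  from first_zero[OF m_cont m_nonneg m_0 \<open>0 \<le> t\<close> this]
  obtain s where s: "0 < s" "m s = 0" "\<And>r. 0 \<le> r \<Longrightarrow> r < s \<Longrightarrow> 0 < m r"
    by metis
  define \<Lambda> where "\<Lambda> = q / (q - 1) * R 0 * m 0 powr (2 / q - 1)"
  have "m 0 * exp (\<Lambda> * 0) \<le> m s * exp (\<Lambda> * s)"
  proof (rule DERIV_nonneg_imp_increasing_open[of 0 s "\<lambda>t. m t * exp (\<Lambda> * t)"])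
    fix r assume r: "0 < r" "r < s"
    then have "0 < m r" using s by auto
    have "((\<lambda>t. m t * exp (\<Lambda> * t)) has_real_derivative
        (\<Lambda> * m r - q / (q - 1) * E r) * exp (\<Lambda> * r)) (at r)"
      using m_deriv_at[OF r(1)] by (auto intro!: derivative_eq_intros simp: algebra_simps)
    moreover have "q / (q - 1) * E r \<le> \<Lambda> * m r"
    proof -
      have "E r = R r * m r powr (2 / q - 1) * m r"
        using E_eq[of r] r \<open>0 < m r\<close> by (simp add: powr_diff)
      also have "\<dots> \<le> R 0 * m 0 powr (2 / q - 1) * m r"
      proof (intro mult_right_mono mult_mono powr_mono2)
        show "R r \<le> R 0" using R_antimono[of 0 r] r \<open>0 < m r\<close> by simp
        show "0 \<le> R 0" using R_lower[of 0] m_0 \<gamma> by simp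
        show "m r \<le> m 0" using m_antimono[of 0 r] r by simp
        show "0 \<le> 2 / q - 1" using q \<open>q \<le> 2\<close> by simp
      qed (use \<open>0 < m r\<close> in auto)
      finally show ?thesis
        using q by (simp add: \<Lambda>_def divide_right_mono mult_left_mono mult.assoc)
    qed
    ultimately show "\<exists>d. ((\<lambda>t. m t * exp (\<Lambda> * t)) has_real_derivative d) (at r) \<and> 0 \<le> d"
      by (intro exI conjI) auto
  qed (use s in \<open>auto intro!: continuous_intros m_cont_Icc\<close>)
  then show False using s m_0 by simp
qed

text \<open>While \<open>m\<close> is positive, \<open>y\<close> decreases at least at rate
  \<open>(q - 2) / (q - 1) * \<gamma>\<close>, so it cannot stay nonnegative forever.\<close>

lemma extinction:
  assumes "2 < q"
  obtains T where "0 < T" "\<And>t. 0 \<le> t \<Longrightarrow> t < T \<Longrightarrow> 0 < m t" "\<And>t. T \<le> t \<Longrightarrow> m t = 0"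
proof -
  \<comment> \<open>The summand 1 takes \<open>s\<close> strictly past the time at which the slowest
    linear decay reaches 0.\<close>
  define s where "s = y 0 / ((q - 2) / (q - 1) * \<gamma>) + 1"
  have "0 < (q - 2) / (q - 1) * \<gamma>" "0 \<le> y 0"
    using assms \<gamma> by (auto simp: y_def)
  then have "0 \<le> y 0 / ((q - 2) / (q - 1) * \<gamma>)"
    by (intro divide_nonneg_pos)
  then have "0 < s" unfolding s_def by linarith
  have "m s = 0"
  proof (rule ccontr)
    assume "m s \<noteq> 0"
    then have "0 < m s" using m_nonneg[of s] \<open>0 < s\<close> by simp
    then have pos: "0 < m r" if "0 \<le> r" "r \<le> s" for r
      using m_antimono[OF that] by simp
    obtain r where r: "0 < r" "r < s" "y s = y 0 - (q - 2) / (q - 1) * R r * (s - 0)"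
      by (rule y_mean_value[of 0 s]) (use pos \<open>0 < s\<close> \<open>2 < q\<close> in auto)
    have "(q - 2) / (q - 1) * \<gamma> * s \<le> (q - 2) / (q - 1) * R r * s"
      using r pos[of r] R_lower[of r] assms by (intro mult_right_mono mult_left_mono) auto
    moreover have "y 0 < (q - 2) / (q - 1) * \<gamma> * s"
    proof -
      have "c * (y 0 / c + 1) = y 0 + c" if "0 < c" for c :: real
        using that by (simp add: distrib_left)
      from this[OF \<open>0 < (q - 2) / (q - 1) * \<gamma>\<close>] \<open>0 < (q - 2) / (q - 1) * \<gamma>\<close>
      show ?thesis unfolding s_def by linarith
    qed
    moreover have "0 \<le> y s" by (simp add: y_def)
    ultimately show False using r(3) by simp
  qed
  from first_zero[OF m_cont m_nonneg m_0 _ this] \<open>0 < s\<close>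
  obtain T where T: "0 < T" "m T = 0" "\<And>r. 0 \<le> r \<Longrightarrow> r < T \<Longrightarrow> 0 < m r"
    by (metis less_imp_le)
  moreover have "m t = 0" if "T \<le> t" for t
    using m_antimono[of T t] m_nonneg[of t] T that by simp
  ultimately show ?thesis using that by blast
qed

section \<open>Explicit bounds for the norm\<close>

definition nrm :: "real \<Rightarrow> real" where
  "nrm t = m t powr (1 / q)"

lemma nrm_conv_y: "q \<noteq> 2 \<Longrightarrow> nrm t = y t powr (1 / (q - 2))"
  using q by (simp add: nrm_def y_def powr_powr)

lemma y_conv_nrm: "y t = nrm t powr (- (2 - q))"
  by (simp add: nrm_def y_def powr_powr)

text \<open>The slope of \<open>y\<close> lies between the values given by \<open>R 0\<close> and
  \<gamma>. Measuring from the extinction time gives the first two bounds, measuring from time 0 the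
  last two.\<close>

lemma extinction_bounds:
  assumes "2 < q" "0 < T" and pos: "\<And>t. 0 \<le> t \<Longrightarrow> t < T \<Longrightarrow> 0 < m t"
    and zero: "\<And>t. T \<le> t \<Longrightarrow> m t = 0" and "0 \<le> t"
  shows "pos_part ((q - 2) / (q - 1) * \<gamma> * (T - t)) powr (1 / (q - 2)) \<le> nrm t"
    and "nrm t \<le> pos_part ((q - 2) / (q - 1) * R 0 * (T - t)) powr (1 / (q - 2))"
    and "pos_part (y 0 - (q - 2) / (q - 1) * R 0 * t) powr (1 / (q - 2)) \<le> nrm t"
    and "nrm t \<le> pos_part (y 0 - (q - 2) / (q - 1) * \<gamma> * t) powr (1 / (q - 2))"
proof -
  have \<kappa>: "0 < (q - 2) / (q - 1)" using assms by simp
  have R: "\<gamma> \<le> R r" "R r \<le> R 0" if "0 \<le> r" "r < T" for r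
    using R_lower[of r] R_antimono[of 0 r] pos that by auto
  have bounds: "(q - 2) / (q - 1) * \<gamma> * (t - s) \<le> y s - y t" "y s - y t \<le> (q - 2) / (q - 1) * R 0 * (t - s)"
    if st: "0 \<le> s" "s < t" "t \<le> T" for s t
  proof -
    obtain r where r: "s < r" "r < t" "y t = y s - (q - 2) / (q - 1) * R r * (t - s)"
      by (rule y_mean_value[of s t]) (use st pos assms(1) in auto)
    have eq: "y s - y t = (q - 2) / (q - 1) * R r * (t - s)"
      using r(3) by simp
    have le: "\<gamma> \<le> R r" "R r \<le> R 0" "0 \<le> t - s" "0 \<le> (q - 2) / (q - 1)"
      using R[of r] r(1,2) st \<kappa> by auto
    show "(q - 2) / (q - 1) * \<gamma> * (t - s) \<le> y s - y t"
      unfolding eq by (intro mult_right_mono mult_left_mono le)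
    show "y s - y t \<le> (q - 2) / (q - 1) * R 0 * (t - s)"
      unfolding eq by (intro mult_right_mono mult_left_mono le)
  qed
  have y0: "y s = 0" if "T \<le> s" for s
    using zero[OF that] by (simp add: y_def)
  have ynn: "0 \<le> y s" for s by (simp add: y_def)
  have "0 < \<gamma>" "0 < R 0" using \<gamma> R[of 0] \<open>0 < T\<close> by auto
  have 1: "pos_part ((q - 2) / (q - 1) * \<gamma> * (T - t)) \<le> y t \<and>
      y t \<le> pos_part ((q - 2) / (q - 1) * R 0 * (T - t)) \<and>
      pos_part (y 0 - (q - 2) / (q - 1) * R 0 * t) \<le> y t \<and>
      y t \<le> pos_part (y 0 - (q - 2) / (q - 1) * \<gamma> * t)"
  proof (cases "t < T")
    case True
    have "y 0 - y t \<le> (q - 2) / (q - 1) * R 0 * t" "(q - 2) / (q - 1) * \<gamma> * t \<le> y 0 - y t"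
      using bounds[of 0 t] True \<open>0 \<le> t\<close> by (cases "t = 0"; simp)+
    then show ?thesis
      using bounds[of t T] True \<open>0 \<le> t\<close> y0[of T] ynn[of t] by (auto simp: pos_part_def)
  next
    \<comment> \<open>After extinction both lower bounds must be 0. For the one measured from time 0
      this holds because even the steepest decay has used up \<open>y 0\<close> by time
      \<open>T\<close>.\<close>
    case False
    have "(q - 2) / (q - 1) * \<gamma> * (T - t) \<le> 0"
      using \<kappa> \<open>0 < \<gamma>\<close> False by (intro mult_nonneg_nonpos mult_nonneg_nonneg) auto
    moreover have "y 0 \<le> (q - 2) / (q - 1) * R 0 * T"
      using bounds(2)[of 0 T] \<open>0 < T\<close> y0[of T] by simp
    moreover have "(q - 2) / (q - 1) * R 0 * T \<le> (q - 2) / (q - 1) * R 0 * t"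
      using \<kappa> \<open>0 < R 0\<close> False by (intro mult_left_mono mult_nonneg_nonneg) auto
    ultimately show ?thesis
      using y0[of t] False by (auto simp: pos_part_def)
  qed
  have "0 \<le> pos_part x" for x by (simp add: pos_part_def)
  with 1 show "pos_part ((q - 2) / (q - 1) * \<gamma> * (T - t)) powr (1 / (q - 2)) \<le> nrm t"
    "nrm t \<le> pos_part ((q - 2) / (q - 1) * R 0 * (T - t)) powr (1 / (q - 2))"
    "pos_part (y 0 - (q - 2) / (q - 1) * R 0 * t) powr (1 / (q - 2)) \<le> nrm t"
    "nrm t \<le> pos_part (y 0 - (q - 2) / (q - 1) * \<gamma> * t) powr (1 / (q - 2))"
    using nrm_conv_y[of t] \<open>2 < q\<close> ynn[of t] by (auto intro!: powr_mono2)
qed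

text \<open>Here \<open>y\<close> grows. The exponent \<open>- 1 / (2 - q)\<close> is negative, so
  the upper bound on \<open>y\<close> gives the lower bound on the norm and conversely.\<close>

lemma fast_decay_bounds:
  assumes "q < 2" "0 < t"
  shows "pos_part (y 0 + (2 - q) / (q - 1) * R 0 * t) powr (- 1 / (2 - q)) \<le> nrm t"
    and "nrm t \<le> pos_part (y 0 + (2 - q) / (q - 1) * \<gamma> * t) powr (- 1 / (2 - q))"
proof -
  have pos: "0 < m s" if "0 \<le> s" for s using m_pos_of_le_2[of s] assms that by simp
  obtain r where r: "0 < r" "r < t" "y t = y 0 - (q - 2) / (q - 1) * R r * (t - 0)"
    by (rule y_mean_value[of 0 t]) (use pos assms in auto)
  have eq: "y t = y 0 + (2 - q) / (q - 1) * R r * t"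
    using r(3) by (simp add: minus_divide_left[symmetric] algebra_simps diff_divide_distrib)
  have le: "\<gamma> \<le> R r" "R r \<le> R 0" "0 \<le> t" "0 \<le> (2 - q) / (q - 1)"
    using R_lower[of r] R_antimono[of 0 r] pos r assms q by auto
  have lower: "y 0 + (2 - q) / (q - 1) * \<gamma> * t \<le> y t"
    unfolding eq by (intro add_left_mono mult_right_mono mult_left_mono le)
  have upper: "y t \<le> y 0 + (2 - q) / (q - 1) * R 0 * t"
    unfolding eq by (intro add_left_mono mult_right_mono mult_left_mono le)
  have "0 < y 0" "0 < y t" using pos[of 0] pos[of t] assms by (auto simp: y_def)
  moreover have "0 < (2 - q) / (q - 1) * \<gamma> * t"
    using assms q \<gamma> by simp
  ultimately have p: "0 < y 0 + (2 - q) / (q - 1) * \<gamma> * t" by simp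
  have e: "1 / (q - 2) = - 1 / (2 - q)"
    using assms by (simp add: field_simps)
  have n: "nrm t = y t powr (- 1 / (2 - q))"
    using nrm_conv_y[of t] assms unfolding e by simp
  have neg: "- 1 / (2 - q) \<le> 0" using assms by simp
  show "pos_part (y 0 + (2 - q) / (q - 1) * R 0 * t) powr (- 1 / (2 - q)) \<le> nrm t"
    unfolding n pos_part_def using upper \<open>0 < y t\<close> neg by (intro powr_mono2') auto
  show "nrm t \<le> pos_part (y 0 + (2 - q) / (q - 1) * \<gamma> * t) powr (- 1 / (2 - q))"
    unfolding n pos_part_def using lower p neg by (intro powr_mono2') auto
qed

end

section \<open>The stencil of the discrete fractional Laplacian\<close>

lemma weight_0: "weight \<theta> h 0 = 0"
  by (simp add: weight_def weight_nat_def)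

lemma weight_minus: "weight \<theta> h (- j) = weight \<theta> h j"
  by (simp add: weight_def)

lemma has_sum_finite_rows:
  fixes g :: "'a \<Rightarrow> 'b \<Rightarrow> real"
  assumes "finite S" "\<And>i. i \<in> S \<Longrightarrow> (g i has_sum s i) UNIV" "\<And>i j. i \<notin> S \<Longrightarrow> g i j = 0"
  shows "((\<lambda>(i, j). g i j) has_sum (\<Sum>i\<in>S. s i)) UNIV"
proof -
  have "((\<lambda>(i, j). g i j) has_sum s i) (Pair i ` UNIV)" if "i \<in> S" for i
    using assms(2)[OF that] by (simp add: has_sum_reindex inj_on_def o_def)
  then have "((\<lambda>(i, j). g i j) has_sum (\<Sum>i\<in>S. s i)) (\<Union>i\<in>S. Pair i ` UNIV)"
    by (intro sum_has_sum assms(1)) auto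
  also have "?this \<longleftrightarrow> ((\<lambda>(i, j). g i j) has_sum (\<Sum>i\<in>S. s i)) UNIV"
    by (rule has_sum_cong_neutral) (use assms(3) in auto)
  finally show ?thesis .
qed

lemma has_sum_convolution:
  fixes w f :: "int \<Rightarrow> real"
  assumes "finite S" "\<And>i. i \<notin> S \<Longrightarrow> f i = 0"
  shows "((\<lambda>j. w j * f (i - j)) has_sum (\<Sum>k\<in>S. w (i - k) * f k)) UNIV"
proof (rule has_sum_finite_neutralI)
  show "finite ((\<lambda>k. i - k) ` S)" using assms(1) by simp
  show "w j * f (i - j) = 0" if "j \<in> UNIV - (\<lambda>k. i - k) ` S" for j
  proof -
    have "i - j \<notin> S" using that by (auto simp: image_iff)
    then show ?thesis using assms(2) by simp
  qed
  show "(\<Sum>k\<in>S. w (i - k) * f k) = (\<Sum>j\<in>(\<lambda>k. i - k) ` S. w j * f (i - j))"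
    by (subst sum.reindex) (auto simp: inj_on_def)
qed simp

text \<open>The matrix of the nonlocal operator on functions vanishing off a finite set. The
  diagonal carries the total weight, since jumps out of the set also count.\<close>

definition stencil :: "(int \<Rightarrow> real) \<Rightarrow> int \<Rightarrow> int \<Rightarrow> real" where
  "stencil w i j = (if i = j then \<Sum>\<^sub>\<infinity>k\<in>UNIV. w k else 0) - w (i - j)"

lemma stencil_sym: "(\<And>k. w (- k) = w k) \<Longrightarrow> stencil w i j = stencil w j i"
  using minus_diff_eq[of i j] by (metis stencil_def)

lemma sum_stencil:
  assumes "finite S" "i \<in> S"
  shows "(\<Sum>j\<in>S. stencil w i j * f j) = (\<Sum>\<^sub>\<infinity>k\<in>UNIV. w k) * f i - (\<Sum>k\<in>S. w (i - k) * f k)"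
proof -
  have "(\<Sum>j\<in>S. stencil w i j * f j) =
      (\<Sum>j\<in>S. (if i = j then (\<Sum>\<^sub>\<infinity>k\<in>UNIV. w k) * f j else 0) - w (i - j) * f j)"
    by (rule sum.cong) (auto simp: stencil_def algebra_simps)
  then show ?thesis
    using assms by (simp add: sum_subtractf)
qed

lemma has_sum_nonlocal_difference:
  fixes w f :: "int \<Rightarrow> real"
  assumes "w summable_on UNIV" "finite S" "\<And>i. i \<notin> S \<Longrightarrow> f i = 0" "i \<in> S"
  shows "((\<lambda>j. w j * (f i - f (i - j))) has_sum (\<Sum>j\<in>S. stencil w i j * f j)) UNIV"
proof -
  have "((\<lambda>j. - (w j * f (i - j))) has_sum - (\<Sum>k\<in>S. w (i - k) * f k)) UNIV"
    using has_sum_convolution[OF assms(2,3), where w = w and i = i] by (simp add: has_sum_uminus)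
  moreover have "((\<lambda>j. w j * f i) has_sum (\<Sum>\<^sub>\<infinity>k\<in>UNIV. w k) * f i) UNIV"
    using assms(1) by (intro has_sum_cmult_left) simp
  ultimately have "((\<lambda>j. w j * f i + - (w j * f (i - j))) has_sum
      (\<Sum>\<^sub>\<infinity>k\<in>UNIV. w k) * f i + - (\<Sum>k\<in>S. w (i - k) * f k)) UNIV"
    by (intro has_sum_add)
  then show ?thesis
    unfolding sum_stencil[OF assms(2,4)] by (simp add: right_diff_distrib)
qed

text \<open>Expand the square. The two pure squares have equal sums, and the mixed term lives on
  finitely many rows; each part is summable by itself.\<close>

lemma has_sum_nonlocal_energy:
  fixes w f :: "int \<Rightarrow> real"
  assumes w: "w summable_on UNIV" "\<And>k. w (- k) = w k" and S: "finite S" "\<And>i. i \<notin> S \<Longrightarrow> f i = 0"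
  shows "((\<lambda>(i, j). w j * \<bar>f i - f (i - j)\<bar>\<^sup>2) has_sum
    2 * (\<Sum>i\<in>S. f i * (\<Sum>j\<in>S. stencil w i j * f j))) UNIV"
proof -
  define W where "W = (\<Sum>\<^sub>\<infinity>k\<in>UNIV. w k)"
  have 1: "((\<lambda>(i, j). w j * (f i)\<^sup>2) has_sum (\<Sum>i\<in>S. W * (f i)\<^sup>2)) UNIV"
    using S w(1) by (intro has_sum_finite_rows has_sum_cmult_left) (auto simp: W_def)
  \<comment> \<open>Reversing each jump \<open>j\<close> from the point \<open>i\<close> exchanges
    the two pure squares, as the weights are even.\<close>
  have "bij_betw (\<lambda>(i, j). (i - j, - j)) (UNIV :: (int \<times> int) set) UNIV"
    by (rule bij_betwI[where g = "\<lambda>(i, j). (i - j, - j)"]) auto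
  from has_sum_reindex_bij_betw[OF this, of "\<lambda>(i, j). w j * (f i)\<^sup>2"] 1
  have 2: "((\<lambda>(i, j). w j * (f (i - j))\<^sup>2) has_sum (\<Sum>i\<in>S. W * (f i)\<^sup>2)) UNIV"
    by (simp add: case_prod_unfold w(2))
  have 3: "((\<lambda>(i, j). - 2 * f i * (w j * f (i - j))) has_sum
      (\<Sum>i\<in>S. - 2 * f i * (\<Sum>k\<in>S. w (i - k) * f k))) UNIV"
    using S by (intro has_sum_finite_rows has_sum_cmult_right has_sum_convolution) auto
  have "((\<lambda>x. (case x of (i, j) \<Rightarrow> w j * (f i)\<^sup>2) + (case x of (i, j) \<Rightarrow> w j * (f (i - j))\<^sup>2)
        + (case x of (i, j) \<Rightarrow> - 2 * f i * (w j * f (i - j)))) has_sum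
      (\<Sum>i\<in>S. W * (f i)\<^sup>2) + (\<Sum>i\<in>S. W * (f i)\<^sup>2)
        + (\<Sum>i\<in>S. - 2 * f i * (\<Sum>k\<in>S. w (i - k) * f k))) UNIV"
    by (intro has_sum_add 1 2 3)
  also have "(\<lambda>x. (case x of (i, j) \<Rightarrow> w j * (f i)\<^sup>2) + (case x of (i, j) \<Rightarrow> w j * (f (i - j))\<^sup>2)
        + (case x of (i, j) \<Rightarrow> - 2 * f i * (w j * f (i - j)))) =
      (\<lambda>(i, j). w j * \<bar>f i - f (i - j)\<bar>\<^sup>2)"
    by (auto simp: power2_eq_square algebra_simps)
  also have "(\<Sum>i\<in>S. W * (f i)\<^sup>2) + (\<Sum>i\<in>S. W * (f i)\<^sup>2)
        + (\<Sum>i\<in>S. - 2 * f i * (\<Sum>k\<in>S. w (i - k) * f k)) =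
      (\<Sum>i\<in>S. 2 * (f i * (\<Sum>j\<in>S. stencil w i j * f j)))"
    unfolding sum.distrib[symmetric]
    by (rule sum.cong[OF refl], subst sum_stencil[OF S(1)])
      (simp_all add: W_def power2_eq_square algebra_simps)
  finally show ?thesis
    by (simp add: sum_distrib_left)
qed

section \<open>The norms as finite sums, and summability of the weights\<close>

lemma X_norm_conv_stencil:
  assumes w: "weight \<theta> h summable_on UNIV" and S: "finite S" "\<And>i. i \<notin> S \<Longrightarrow> f i = 0"
  shows "X_norm \<theta> h f = sqrt (h * (\<Sum>i\<in>S. f i * (\<Sum>j\<in>S. stencil (weight \<theta> h) i j * f j)))"
proof -
  have "((\<lambda>x. h * (case x of (i, j) \<Rightarrow> weight \<theta> h j * \<bar>f i - f (i - j)\<bar>\<^sup>2)) has_sum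
      h * (2 * (\<Sum>i\<in>S. f i * (\<Sum>j\<in>S. stencil (weight \<theta> h) i j * f j)))) UNIV"
    by (intro has_sum_cmult_right has_sum_nonlocal_energy w S weight_minus)
  then have "((\<lambda>(i, j). h * weight \<theta> h j * \<bar>f i - f (i - j)\<bar>\<^sup>2) has_sum
      h * (2 * (\<Sum>i\<in>S. f i * (\<Sum>j\<in>S. stencil (weight \<theta> h) i j * f j)))) UNIV"
    by (simp add: case_prod_unfold mult.assoc)
  then show ?thesis
    unfolding X_norm_def by (simp add: infsumI)
qed

lemma lq_norm_finite_support:
  assumes "finite S" "\<And>i. i \<notin> S \<Longrightarrow> f i = 0"
  shows "lq_norm h q f = (h * (\<Sum>i\<in>S. \<bar>f i\<bar> powr q)) powr (1 / q)"
proof -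
  have "((\<lambda>i. h * \<bar>f i\<bar> powr q) has_sum (\<Sum>i\<in>S. h * \<bar>f i\<bar> powr q)) UNIV"
    by (rule has_sum_finite_neutralI) (use assms in auto)
  then show ?thesis
    by (simp add: lq_norm_def infsumI sum_distrib_left)
qed

text \<open>The embedding inequality forces the double series in \<^const>\<open>X_norm\<close> to converge for the
  discrete Dirac mass, since a divergent series has the value 0.\<close>

lemma weight_summable:
  assumes "0 < h" "0 < q"
    and embed: "\<And>f. f \<in> X_space M \<Longrightarrow> lq_norm h q f \<le> C * X_norm \<theta> h f"
  shows "weight \<theta> h summable_on UNIV"
proof -
  define f :: "int \<Rightarrow> real" where "f i = (if i = 0 then 1 else 0)" for i
  have "lq_norm h q f = h powr (1 / q)"
    using lq_norm_finite_support[of "{0}" f h q] by (simp add: f_def)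
  moreover have "f \<in> X_space M" by (simp add: X_space_def f_def)
  ultimately have "X_norm \<theta> h f \<noteq> 0"
    using embed[of f] \<open>0 < h\<close> by auto
  then have "(\<Sum>\<^sub>\<infinity>(i, j)\<in>UNIV. h * weight \<theta> h j * \<bar>f i - f (i - j)\<bar>\<^sup>2) \<noteq> 0"
    by (auto simp: X_norm_def)
  then have "(\<lambda>(i, j). h * weight \<theta> h j * \<bar>f i - f (i - j)\<bar>\<^sup>2) summable_on (SIGMA i:UNIV. UNIV)"
    using infsum_not_exists by fastforce
  \<comment> \<open>In the row \<open>i = 0\<close> the squared difference is 1 for every nonzero
    \<open>j\<close>, and at \<open>j = 0\<close> the weight itself is 0.\<close>
  then have "(\<lambda>j. h * weight \<theta> h j * \<bar>f 0 - f (0 - j)\<bar>\<^sup>2) summable_on UNIV"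
    by (rule summable_on_SigmaD1) simp
  also have "(\<lambda>j. h * weight \<theta> h j * \<bar>f 0 - f (0 - j)\<bar>\<^sup>2) = (\<lambda>j. h * weight \<theta> h j)"
    by (auto simp: f_def weight_0)
  finally have "(\<lambda>j. inverse h * (h * weight \<theta> h j)) summable_on UNIV"
    by (rule summable_on_cmult_right)
  then show ?thesis
    using \<open>0 < h\<close> by (simp add: mult.assoc[symmetric])
qed

section \<open>Transfer to the semi-discrete scheme\<close>

theorem proposition9:
  fixes \<theta> L h q C :: real and M :: nat
    and u0 :: "int \<Rightarrow> real" and v :: "real \<Rightarrow> int \<Rightarrow> real"
  assumes "0 < \<theta>" "\<theta> < 1" "L > 0"
    and "1 < q" "ereal q \<le> two_star \<theta>"
    and "space_step L h M"
    and "u0 \<in> X_space M" "u0 \<noteq> (\<lambda>_. 0)"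
    and "C > 0"
    and "\<And>h' M' f. space_step L h' M' \<Longrightarrow> f \<in> X_space M' \<Longrightarrow>
           lq_norm h' q f \<le> C * X_norm \<theta> h' f"
    and "semidiscrete_solution \<theta> h M q u0 v"
  defines "R \<equiv> \<lambda>t. rayleigh \<theta> h q (v t)"
  shows
    "(q \<noteq> 2 \<longrightarrow> (\<forall>t>0.
        pos_part (lq_norm h q u0 powr (- (2 - q)) + (2 - q) / (q - 1) * R 0 * t)
            powr (- 1 / (2 - q)) \<le> lq_norm h q (v t) \<and>
        lq_norm h q (v t) \<le>
          pos_part (lq_norm h q u0 powr (- (2 - q)) + (2 - q) / (q - 1) * C powr (- 2) * t)
            powr (- 1 / (2 - q)))) \<and>
     (q > 2 \<longrightarrow> (\<exists>t_star>0.
        (\<forall>t>0.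
          pos_part ((q - 2) / (q - 1) * C powr (- 2) * (t_star - t)) powr (1 / (q - 2))
            \<le> lq_norm h q (v t) \<and>
          lq_norm h q (v t) \<le>
            pos_part ((q - 2) / (q - 1) * R 0 * (t_star - t)) powr (1 / (q - 2))) \<and>
        (\<forall>t\<in>{0..<t_star}. v t \<noteq> (\<lambda>_. 0)) \<and> antimono_on {0..<t_star} R)) \<and>
     (q \<le> 2 \<longrightarrow> (\<forall>t\<in>{0..}. v t \<noteq> (\<lambda>_. 0)) \<and> antimono_on {0..} R)"
proof -
  define S where "S = {- int M..int M}"
  define K where "K = stencil (weight \<theta> h)"
  define p where "p = 1 / (q - 1)"
  define a where "a t i = odd_pow (v t i) (q - 1)" for t i
  have [simp]: "finite S" by (simp add: S_def)
  have S_iff: "i \<in> S \<longleftrightarrow> \<bar>i\<bar> \<le> int M" for i by (auto simp: S_def)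
  have "0 < h" using assms(6) by (simp add: space_step_def)
  have q: "1 < q" "0 < q - 1" "0 < q" and "0 < p" using assms(4) by (simp_all add: p_def)
  have embed: "lq_norm h q f \<le> C * X_norm \<theta> h f" if "f \<in> X_space M" for f
    using assms(6,10) that by blast
  have X: "f \<in> X_space M \<longleftrightarrow> (\<forall>i. i \<notin> S \<longrightarrow> f i = 0)" for f
    by (auto simp: X_space_def S_iff not_le)
  have w: "weight \<theta> h summable_on UNIV"
    using weight_summable[OF \<open>0 < h\<close> \<open>0 < q\<close> embed] .
  define form where "form f = (\<Sum>i\<in>S. f i * (\<Sum>j\<in>S. K i j * f j))" for f
  have X_norm: "X_norm \<theta> h f = sqrt (h * form f)" if "f \<in> X_space M" for f
    unfolding form_def K_def using that by (intro X_norm_conv_stencil w) (auto simp: X)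
  have lq: "lq_norm h q f = (h * (\<Sum>i\<in>S. \<bar>f i\<bar> powr q)) powr (1 / q)" if "f \<in> X_space M" for f
    using that by (intro lq_norm_finite_support) (auto simp: X)
  have lq_pos: "0 < lq_norm h q f" if "f \<in> X_space M" "i \<in> S" "f i \<noteq> 0" for f i
  proof -
    have "0 < (\<Sum>i\<in>S. \<bar>f i\<bar> powr q)"
      using that by (intro sum_pos2[of S i]) auto
    then show ?thesis using \<open>0 < h\<close> by (simp add: lq[OF that(1)])
  qed
  \<comment> \<open>Definiteness comes from the embedding: the extension by zero has positive norm,
    which is at most \<open>C * sqrt (h * form g)\<close>.\<close>
  have form_pos: "0 < form f" if nz: "\<exists>i\<in>S. f i \<noteq> 0" for f
  proof -
    define g where "g i = (if i \<in> S then f i else 0)" for i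
    obtain i where "i \<in> S" "f i \<noteq> 0" using nz by blast
    have "g \<in> X_space M" by (simp add: X g_def)
    moreover have "0 < lq_norm h q g"
      using lq_pos[of g i] \<open>g \<in> X_space M\<close> \<open>i \<in> S\<close> \<open>f i \<noteq> 0\<close> by (simp add: g_def)
    ultimately have "0 < C * sqrt (h * form g)"
      using embed[of g] X_norm[of g] by simp
    then have "0 < h * form g"
      using \<open>0 < C\<close> by (simp add: zero_less_mult_iff)
    then have "0 < form g" using \<open>0 < h\<close> by (simp add: zero_less_mult_iff)
    moreover have "form g = form f"
      by (simp add: form_def g_def cong: sum.cong)
    ultimately show ?thesis by simp
  qed
  note sol = assms(11)[unfolded semidiscrete_solution_def]
  have vX: "v t \<in> X_space M" if "0 \<le> t" for t
    using sol that by (simp add: X_space_def)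
  have va: "v t i = odd_pow (a t i) p" for t i
    using odd_pow_inverse[of "q - 1" "v t i"] q by (simp add: a_def p_def)
  have lap: "frac_lap \<theta> h (v t) i = (\<Sum>j\<in>S. K i j * odd_pow (a t j) p)" if "0 \<le> t" "i \<in> S" for t i
  proof -
    have "((\<lambda>j. weight \<theta> h j * (v t i - v t (i - j))) has_sum (\<Sum>j\<in>S. K i j * v t j)) UNIV"
      unfolding K_def using vX[OF that(1)] that(2) by (intro has_sum_nonlocal_difference w) (auto simp: X)
    then show ?thesis by (simp add: frac_lap_def infsumI va[symmetric])
  qed
  have ca: "continuous_on {0..} (\<lambda>t. a t i)" for i
    using sol by (simp add: a_def)
  interpret flow: doubly_nonlinear_flow S K p a
  proof
    show "K i j = K j i" for i j
      unfolding K_def by (rule stencil_sym) (rule weight_minus)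
    show "0 < (\<Sum>i\<in>S. f i * (\<Sum>j\<in>S. K i j * f j))" if "\<exists>i\<in>S. f i \<noteq> 0" for f
      using form_pos[OF that] by (simp add: form_def)
    show "((\<lambda>t. a t i) has_real_derivative - (\<Sum>j\<in>S. K i j * odd_pow (a t j) p)) (at t within {0..})"
      if "0 \<le> t" "i \<in> S" for t i
    \<comment> \<open>The right-hand side depends continuously on \<open>a\<close>, so the weak
      derivative is classical up to time 0.\<close>
    proof (rule weak_deriv_imp_has_real_derivative[OF ca _ _ \<open>0 \<le> t\<close>])
      show "continuous_on {0..} (\<lambda>t. - (\<Sum>j\<in>S. K i j * odd_pow (a t j) p))"
        by (intro continuous_intros continuous_on_odd_pow ca \<open>0 < p\<close>)
      fix T :: real assume "0 < T"
      then obtain g where g: "has_weak_deriv T (\<lambda>t. a t i) g"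
        "AE t in lborel. t \<in> {0<..<T} \<longrightarrow> g t + frac_lap \<theta> h (v t) i = 0"
        using sol \<open>i \<in> S\<close> unfolding S_iff a_def by blast
      have "AE t in lborel. t \<in> {0<..<T} \<longrightarrow> g t = - (\<Sum>j\<in>S. K i j * odd_pow (a t j) p)"
        using g(2) by eventually_elim (use lap[OF _ \<open>i \<in> S\<close>] in fastforce)
      then show "\<exists>g. has_weak_deriv T (\<lambda>t. a t i) g \<and>
          (AE t in lborel. t \<in> {0<..<T} \<longrightarrow> g t = - (\<Sum>j\<in>S. K i j * odd_pow (a t j) p))"
        using g(1) by blast
    qed
  qed (use \<open>0 < p\<close> in auto)
  have fv: "flow.v t = v t" for t
    by (rule ext) (simp add: flow.v_def va)
  define m where "m t = h * flow.mass t" for t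
  define E where "E t = h * flow.energy t" for t
  have p: "p + 1 = q / (q - 1)" "2 * p / (p + 1) = 2 / q"
    using q by (simp_all add: p_def field_simps)
  have mass: "flow.mass t = (\<Sum>i\<in>S. \<bar>v t i\<bar> powr q)" for t
  proof -
    have "v t i * odd_pow (v t i) (q - 1) = \<bar>v t i\<bar> powr q" for i
      using mult_odd_pow[of "v t i" "q - 1"] by simp
    then show ?thesis
      by (simp add: flow.mass_def fv a_def mult.commute)
  qed
  have nrm: "lq_norm h q (v t) = m t powr (1 / q)" if "0 \<le> t" for t
    by (simp add: lq[OF vX[OF that]] m_def mass)
  have energy: "flow.energy t = form (v t)" for t
    by (simp add: flow.energy_def form_def fv flow.Kop_def)
  have X_norm_sq: "(X_norm \<theta> h (v t))\<^sup>2 = E t" if "0 \<le> t" for t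
    using flow.energy_nonneg[of t] \<open>0 < h\<close> by (simp add: X_norm[OF vX[OF that]] energy E_def)
  have R: "R t = E t / m t powr (2 / q)" if "0 \<le> t" for t
    unfolding R_def rayleigh_def X_norm_sq[OF that] nrm[OF that]
    by (simp add: power2_eq_square powr_add[symmetric])
  \<comment> \<open>A constant positive factor, so monotonicity of \<open>flow.quotient\<close>
    carries over to \<open>R\<close>.\<close>
  have R_quotient: "R t = h / h powr (2 / q) * flow.quotient t" if "0 \<le> t" for t
    using \<open>0 < h\<close> flow.mass_nonneg[of t]
    by (simp add: R[OF that] E_def m_def flow.quotient_def p(2) powr_mult)
  have u0: "v 0 = u0"
  proof
    show "v 0 i = u0 i" for i
      using sol vX[of 0] assms(7) by (cases "i \<in> S") (auto simp: X S_iff)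
  qed
  have pos_iff: "0 < m t \<longleftrightarrow> v t \<noteq> (\<lambda>_. 0)" if "0 \<le> t" for t
  proof -
    have "0 < m t \<longleftrightarrow> \<not> (\<forall>i\<in>S. \<bar>v t i\<bar> powr q = 0)"
      unfolding m_def mass using \<open>0 < h\<close>
      by (subst sum_nonneg_eq_0_iff[symmetric]) (auto simp: zero_less_mult_iff less_le sum_nonneg)
    then show ?thesis
      using vX[OF that] by (auto simp: X fun_eq_iff)
  qed
  interpret decay: rayleigh_decay q "C powr (- 2)" m E R
  proof
    show "1 < q" "0 < C powr (- 2)" using q \<open>0 < C\<close> by auto
    show "0 \<le> m t" for t using \<open>0 < h\<close> flow.mass_nonneg[of t] by (simp add: m_def)
    show "0 < m 0" using pos_iff[of 0] u0 assms(8) by simp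
    show "0 \<le> E t" for t using \<open>0 < h\<close> flow.energy_nonneg[of t] by (simp add: E_def)
    fix t :: real assume t: "0 \<le> t"
    show "(m has_real_derivative - (q / (q - 1)) * E t) (at t within {0..})"
      unfolding m_def[abs_def] E_def p(1)[symmetric]
      using DERIV_cmult[OF flow.mass_has_derivative[OF t], of h] by (simp add: algebra_simps)
    assume "0 < m t"
    then show "E t = R t * m t powr (2 / q)" by (simp add: R[OF t])
    have "0 < lq_norm h q (v t)" using \<open>0 < m t\<close> by (simp add: nrm[OF t])
    \<comment> \<open>The embedding, squared, is the lower bound \<open>C powr (- 2)\<close> for
      \<open>R\<close>.\<close>
    moreover from this have "(lq_norm h q (v t))\<^sup>2 \<le> (C * X_norm \<theta> h (v t))\<^sup>2"
      by (intro power_mono embed vX t) simp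
    ultimately show "C powr (- 2) \<le> R t"
      using \<open>0 < C\<close>
      by (simp add: R_def rayleigh_def powr_minus powr_numeral power_mult_distrib field_simps)
  next
    fix s t assume "0 \<le> s" "s \<le> t" "\<And>\<tau>. s \<le> \<tau> \<Longrightarrow> \<tau> \<le> t \<Longrightarrow> 0 < m \<tau>"
    then show "R t \<le> R s"
      using flow.quotient_antimono[of s t] \<open>0 < h\<close>
      by (auto simp: R_quotient m_def zero_less_mult_iff intro!: divide_right_mono mult_left_mono)
  qed
  have nrm': "lq_norm h q (v t) = decay.nrm t" if "0 \<le> t" for t
    by (simp add: nrm[OF that] decay.nrm_def)
  have y0: "lq_norm h q u0 powr (- (2 - q)) = decay.y 0"
    using nrm'[of 0] by (simp add: decay.y_conv_nrm u0)
  have mono: "antimono_on A R" if "A \<subseteq> {0..}" "\<And>t. t \<in> A \<Longrightarrow> 0 < m t" for A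
    using that by (intro monotone_onI decay.R_antimono) auto
  have sgn: "(2 - q) / (q - 1) * r * t = - ((q - 2) / (q - 1) * r * t)" for r t
    by (simp add: minus_divide_left algebra_simps)
  consider "q < 2" | "q = 2" | "2 < q" by linarith
  then show ?thesis
  proof cases
    case 1
    have "0 < m t" if "0 \<le> t" for t using decay.m_pos_of_le_2 1 that by simp
    then show ?thesis
      using 1 decay.fast_decay_bounds[OF 1] y0 nrm' mono[of "{0..}"] pos_iff by simp
  next
    case 2
    have "0 < m t" if "0 \<le> t" for t using decay.m_pos_of_le_2 2 that by simp
    then show ?thesis
      using 2 mono[of "{0..}"] pos_iff by simp
  next
    case 3
    obtain T where T: "0 < T" "\<And>t. 0 \<le> t \<Longrightarrow> t < T \<Longrightarrow> 0 < m t" "\<And>t. T \<le> t \<Longrightarrow> m t = 0"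
      using decay.extinction[OF 3] by blast
    \<comment> \<open>The extinction time \<open>T\<close> serves as \<open>t_star\<close>. The
      bounds of (1) come from the third and fourth estimate and hold beyond \<open>T\<close> as
      well.\<close>
    note bounds = decay.extinction_bounds[OF 3 T]
    have e: "- 1 / (2 - q) = 1 / (q - 2)" using 3 by (simp add: field_simps)
    have "(\<forall>t>0.
        pos_part (lq_norm h q u0 powr (- (2 - q)) + (2 - q) / (q - 1) * R 0 * t)
            powr (- 1 / (2 - q)) \<le> lq_norm h q (v t) \<and>
        lq_norm h q (v t) \<le>
          pos_part (lq_norm h q u0 powr (- (2 - q)) + (2 - q) / (q - 1) * C powr (- 2) * t)
            powr (- 1 / (2 - q)))"
      unfolding y0 sgn e using bounds(3,4) nrm' by simp
    moreover have "\<forall>t>0.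
          pos_part ((q - 2) / (q - 1) * C powr (- 2) * (T - t)) powr (1 / (q - 2))
            \<le> lq_norm h q (v t) \<and>
          lq_norm h q (v t) \<le>
            pos_part ((q - 2) / (q - 1) * R 0 * (T - t)) powr (1 / (q - 2))"
      using bounds(1,2) nrm' by simp
    moreover have "\<forall>t\<in>{0..<T}. v t \<noteq> (\<lambda>_. 0)"
      using T(2) pos_iff by simp
    moreover have "antimono_on {0..<T} R"
      using T(2) by (intro mono) auto
    ultimately show ?thesis using 3 T(1) by auto
  qed
qed

end
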